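(* For a triple $(x_1,x_2,x_3)$ let $G$ be the group generated by the reflections $R_1,R_2,R_3$ attached to it. The $B_3$-orbit of $(-2\cos\frac\pi2,-2\cos\frac\pi3,-2\cos\frac\pi3)$ corresponds to the group $W(A_3)$ of symmetries of the regular tetrahedron (that is, $G=W(A_3)$ for the triples of this orbit). The orbit of $(-2\cos\frac\pi2,-2\cos\frac\pi3,-2\cos\frac\pi4)$ corresponds to the group $W(B_3)$ of symmetries of the regular octahedron. The three (pairwise distinct) orbits of $(-2\cos\frac\pi2,-2\cos\frac\pi3,-2\cos\frac\pi5)$, of $(-2\cos\frac\pi2,-2\cos\frac\pi3,-2\cos\frac{2\pi}5)$ and of $(-2\cos\frac\pi2,-2\cos\frac\pi5,-2\cos\frac{2\pi}5)$ correspond to different choices of a system of generating reflections in the group $W(H_3)$ of symmetries of the icosahedron.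
   Context: For real $(x_1,x_2,x_3)$ let $V$ be a three-dimensional space with basis $e_1,e_2,e_3$ and symmetric bilinear form $(e_i,e_i)=2$, $(e_1,e_2)=x_1$, $(e_2,e_3)=x_2$, $(e_1,e_3)=x_3$. The reflections are $R_i(v)=v-(e_i,v)e_i$, $i=1,2,3$. For the triples in question the form is positive definite, so $G$ acts in Euclidean 3-space; identification of $G$ with a symmetry group is up to isometry. $B_3=\langle\beta_1,\beta_2\mid\beta_1\beta_2\beta_1=\beta_2\beta_1\beta_2\rangle$ acts on triples by $\beta_1:(x_1,x_2,x_3)\mapsto(-x_1,x_3-x_1x_2,x_2)$, $\beta_2:(x_1,x_2,x_3)\mapsto(x_3,-x_2,x_1-x_2x_3)$. Triples are considered modulo changing the signs of two of the coordinates. Correspondingly $B_3$ acts on systems of generating reflections by $\beta_1:(R_1,R_2,R_3)\mapsto(R_2,R_2R_1R_2,R_3)$, $\beta_2:(R_1,R_2,R_3)\mapsto(R_1,R_3,R_3R_2R_3)$. *)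

theory Defs
  imports "HOL-Analysis.Analysis" "HOL-Algebra.Bij" "HOL-Algebra.Generated_Groups"
begin

type_synonym triple = "real \<times> real \<times> real"
type_synonym vmap = "real^3 \<Rightarrow> real^3"
type_synonym refl_system = "vmap \<times> vmap \<times> vmap"

definition cos_triple :: "real \<Rightarrow> real \<Rightarrow> real \<Rightarrow> triple" where
  "cos_triple a b c = (- 2 * cos a, - 2 * cos b, - 2 * cos c)"


section \<open>The reflection group of a triple\<close>

text \<open>
  The space \<open>V\<close> is modelled by its coordinate space \<open>real^3\<close>, with \<open>e\<^sub>i = axis i 1\<close>. The form
  attached to a triple is unrelated to the library's inner product on \<open>real^3\<close>, which is used
  only for the Euclidean space in which the regular polyhedra live.
\<close>

definition gram :: "triple \<Rightarrow> real^3^3" where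
  "gram = (\<lambda>(x1, x2, x3). vector [vector [2, x1, x3], vector [x1, 2, x2], vector [x3, x2, 2]])"

definition form :: "triple \<Rightarrow> real^3 \<Rightarrow> real^3 \<Rightarrow> real" where
  "form x u v = (\<Sum>i\<in>UNIV. \<Sum>j\<in>UNIV. gram x $ i $ j * u $ i * v $ j)"

definition reflect :: "triple \<Rightarrow> 3 \<Rightarrow> vmap" where
  "reflect x i v = v - form x (axis i 1) v *\<^sub>R axis i 1"

definition reflections :: "triple \<Rightarrow> refl_system" where
  "reflections x = (reflect x 1, reflect x 2, reflect x 3)"

definition generated_group :: "refl_system \<Rightarrow> vmap set" where
  "generated_group = (\<lambda>(S1, S2, S3). generate (BijGroup UNIV) {S1, S2, S3})"

abbreviation reflection_group :: "triple \<Rightarrow> vmap set" where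
  "reflection_group x \<equiv> generated_group (reflections x)"


section \<open>The braid group actions\<close>

definition braid1 :: "triple \<Rightarrow> triple" where
  "braid1 = (\<lambda>(x1, x2, x3). (- x1, x3 - x1 * x2, x2))"

definition braid2 :: "triple \<Rightarrow> triple" where
  "braid2 = (\<lambda>(x1, x2, x3). (x3, - x2, x1 - x2 * x3))"

definition sign_changes :: "triple \<Rightarrow> triple set" where
  "sign_changes = (\<lambda>(x1, x2, x3). {(- x1, - x2, x3), (x1, - x2, - x3), (- x1, x2, - x3)})"

text \<open>
  Since the generators act by bijections, the orbits of the group they generate are the classes of
  the generated equivalence relation. A \<open>B\<^sub>3\<close>-orbit on triples modulo sign changes is represented
  by the set of all triples whose class lies in that orbit.
\<close>

definition triple_orbit :: "triple \<Rightarrow> triple set" where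
  "triple_orbit x =
     {y. equivclp (\<lambda>a b. b = braid1 a \<or> b = braid2 a \<or> b \<in> sign_changes a) x y}"

definition sys_braid1 :: "refl_system \<Rightarrow> refl_system" where
  "sys_braid1 = (\<lambda>(R1, R2, R3). (R2, R2 \<circ> R1 \<circ> R2, R3))"

definition sys_braid2 :: "refl_system \<Rightarrow> refl_system" where
  "sys_braid2 = (\<lambda>(R1, R2, R3). (R1, R3, R3 \<circ> R2 \<circ> R3))"

text \<open>On systems of involutions the two maps are bijective, so the same encoding applies.\<close>

definition system_orbit :: "refl_system \<Rightarrow> refl_system set" where
  "system_orbit S = {T. equivclp (\<lambda>a b. b = sys_braid1 a \<or> b = sys_braid2 a) S T}"


section \<open>Identification with a group acting in Euclidean space\<close>

definition transport :: "vmap \<Rightarrow> vmap \<Rightarrow> vmap" where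
  "transport \<phi> g = \<phi> \<circ> g \<circ> the_inv \<phi>"

definition transport_system :: "vmap \<Rightarrow> refl_system \<Rightarrow> refl_system" where
  "transport_system \<phi> = (\<lambda>(S1, S2, S3). (transport \<phi> S1, transport \<phi> S2, transport \<phi> S3))"

text \<open>Existence of such a map forces the form of \<open>x\<close> to be positive definite.\<close>

definition isometry_to_euclidean :: "triple \<Rightarrow> vmap \<Rightarrow> bool" where
  "isometry_to_euclidean x \<phi> \<longleftrightarrow>
     linear \<phi> \<and> bij \<phi> \<and> (\<forall>u v. \<phi> u \<bullet> \<phi> v = form x u v)"

definition identifies :: "vmap \<Rightarrow> triple \<Rightarrow> vmap set \<Rightarrow> bool" where
  "identifies \<phi> x W \<longleftrightarrow> isometry_to_euclidean x \<phi> \<and> transport \<phi> ` reflection_group x = W"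

definition reflection_along :: "real^3 \<Rightarrow> vmap" where
  "reflection_along n v = v - (2 * (n \<bullet> v) / (n \<bullet> n)) *\<^sub>R n"

definition generating_reflections :: "vmap set \<Rightarrow> refl_system \<Rightarrow> bool" where
  "generating_reflections W = (\<lambda>(S1, S2, S3).
     (\<forall>s\<in>{S1, S2, S3}. \<exists>n. n \<noteq> 0 \<and> s = reflection_along n) \<and>
     generated_group (S1, S2, S3) = W)"

text \<open>
  Choices of a system are compared up to the braid group action and up to simultaneous
  conjugation by an isometry (the two commute).
\<close>

definition same_choice :: "refl_system \<Rightarrow> refl_system \<Rightarrow> bool" where
  "same_choice S T \<longleftrightarrow>
     (\<exists>g. orthogonal_transformation g \<and> transport_system g T \<in> system_orbit S)"


section \<open>Symmetry groups of the regular polyhedra\<close>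

definition symmetries :: "(real^3) set \<Rightarrow> vmap set" where
  "symmetries P = {f. (\<forall>u v. dist (f u) (f v) = dist u v) \<and> f ` P = P}"

definition tetrahedron :: "(real^3) set" where
  "tetrahedron = convex hull
     {vector [1, 1, 1], vector [1, - 1, - 1], vector [- 1, 1, - 1], vector [- 1, - 1, 1]}"

definition octahedron :: "(real^3) set" where
  "octahedron = convex hull {axis i s | i s. s \<in> {1, - 1}}"

text \<open>The twelve vertices are the cyclic permutations of \<open>(0, \<plusminus>1, \<plusminus>\<tau>)\<close>, \<open>\<tau>\<close> the golden ratio.\<close>

definition icosahedron :: "(real^3) set" where
  "icosahedron = (let \<tau> = (1 + sqrt 5) / 2 in convex hull
     (\<Union>s\<in>{1, - 1}. \<Union>t\<in>{\<tau>, - \<tau>}. {vector [0, s, t], vector [s, t, 0], vector [t, 0, s]}))"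

abbreviation W_A3 :: "vmap set" where "W_A3 \<equiv> symmetries tetrahedron"
abbreviation W_B3 :: "vmap set" where "W_B3 \<equiv> symmetries octahedron"
abbreviation W_H3 :: "vmap set" where "W_H3 \<equiv> symmetries icosahedron"

definition H3_triples :: "triple list" where
  "H3_triples =
     [cos_triple (pi/2) (pi/3) (pi/5),
      cos_triple (pi/2) (pi/3) (2*pi/5),
      cos_triple (pi/2) (pi/5) (2*pi/5)]"

end

(* A triple with positive definite form is the Gram matrix of three vectors of length sqrt 2, and a
   braid move or a sign change only replaces these vectors by others generating the same
   reflection group; so it suffices to treat the starting triples. There, a symmetry of the
   polyhedron fixes the centre and permutes the vertices, and reflections of the group carry the
   images of three independent vertices back to the vertices themselves. For the icosahedron all
   three systems consist of two coordinate reflections and the reflection along (t, 1, t - 1), with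
   t the golden ratio; they differ only in which two coordinates are chosen.

   The product of the three reflections is invariant under braid moves, and its trace is
   x1^2 + x2^2 + x3^2 - x1 x2 x3 - 3; this separates the three icosahedral orbits. *)

theory Submission
  imports Defs
begin

section \<open>Groups generated by three involutions\<close>

text \<open>Orbits are classes of a generated equivalence, so every move must also be followed
  backwards: involutivity has to be pulled back through the braid maps, and a change of basis has to
  be replaced by its inverse. The link between the two braid actions is that reflecting a vector
  conjugates its reflection. Hence the basis change that turns one form into the next carries the
  transported system to its braid image. An isometry to Euclidean space is unique only up to an
  orthogonal map, which the conjugation allowed in \<open>same_choice\<close> absorbs. The three
  icosahedral systems generate the same group, so the group cannot tell them apart. Their products
  can: with the golden ratio t the traces are t - 1, -t and 0, belonging to rotary reflections with
  angles pi/5, 3 pi/5 and pi/3.\<close>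

lemma Bij_UNIV: "Bij UNIV = {f. bij f}"
  by (auto simp: Bij_def extensional_def)

lemma carrier_BijGroup_UNIV: "carrier (BijGroup UNIV) = {f. bij f}"
  by (simp add: BijGroup_def Bij_UNIV)

lemma mult_BijGroup_UNIV: "bij f \<Longrightarrow> bij g \<Longrightarrow> f \<otimes>\<^bsub>BijGroup UNIV\<^esub> g = f \<circ> g"
  by (simp add: BijGroup_def Bij_UNIV compose_def fun_eq_iff)

lemma one_BijGroup_UNIV: "\<one>\<^bsub>BijGroup UNIV\<^esub> = id"
  by (simp add: BijGroup_def fun_eq_iff)

text \<open>An involution is a bijection and its own inverse. Both facts are used to compute in
  \<open>BijGroup UNIV\<close>, whose multiplication is composition on bijections only.\<close>

definition involutive_system :: "refl_system \<Rightarrow> bool" where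
  "involutive_system = (\<lambda>(S1, S2, S3). S1 \<circ> S1 = id \<and> S2 \<circ> S2 = id \<and> S3 \<circ> S3 = id)"

lemma inv_BijGroup_involution:
  assumes "s \<circ> s = id" shows "inv\<^bsub>BijGroup UNIV\<^esub> s = s"
proof -
  interpret group "BijGroup UNIV" by (rule group_BijGroup)
  have "bij s" using assms by (simp add: o_bij)
  then show ?thesis
    using assms
    by (intro inv_equality) (auto simp: mult_BijGroup_UNIV one_BijGroup_UNIV carrier_BijGroup_UNIV)
qed

lemma generated_group_bij:
  assumes "involutive_system (S1, S2, S3)" and "f \<in> generated_group (S1, S2, S3)"
  shows "bij f"
proof -
  interpret group "BijGroup UNIV" by (rule group_BijGroup)
  have "{S1, S2, S3} \<subseteq> carrier (BijGroup UNIV)"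
    using assms(1) by (auto simp: carrier_BijGroup_UNIV involutive_system_def intro: o_bij)
  then have "f \<in> carrier (BijGroup UNIV)"
    by (rule generate_in_carrier) (use assms(2) in \<open>simp add: generated_group_def\<close>)
  then show ?thesis by (simp add: carrier_BijGroup_UNIV)
qed

lemma generated_group_gens:
  "S1 \<in> generated_group (S1, S2, S3)" "S2 \<in> generated_group (S1, S2, S3)"
  "S3 \<in> generated_group (S1, S2, S3)"
  by (auto simp: generated_group_def intro: generate.incl)

lemma id_in_generated_group: "id \<in> generated_group (S1, S2, S3)"
  using generate.one[of "BijGroup UNIV"] by (auto simp: generated_group_def one_BijGroup_UNIV)

lemma comp_in_generated_group:
  assumes "involutive_system (S1, S2, S3)"
    and "f \<in> generated_group (S1, S2, S3)" "g \<in> generated_group (S1, S2, S3)"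
  shows "f \<circ> g \<in> generated_group (S1, S2, S3)"
  using assms(2,3) generated_group_bij[OF assms(1)] generate.eng[of f "BijGroup UNIV" "{S1, S2, S3}" g]
  by (auto simp: generated_group_def mult_BijGroup_UNIV)

text \<open>Closure of \<open>X\<close> under composition suffices, because each generator is its
  own inverse.\<close>

lemma generated_group_least:
  assumes inv: "involutive_system (S1, S2, S3)"
    and id: "id \<in> X" and gens: "S1 \<in> X" "S2 \<in> X" "S3 \<in> X"
    and comp: "\<And>f g. f \<in> X \<Longrightarrow> g \<in> X \<Longrightarrow> f \<circ> g \<in> X"
  shows "generated_group (S1, S2, S3) \<subseteq> X"
proof
  fix f assume "f \<in> generated_group (S1, S2, S3)"
  then have "f \<in> generate (BijGroup UNIV) {S1, S2, S3}"
    by (simp add: generated_group_def)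
  then show "f \<in> X"
  proof induction
    case one
    show ?case using id by (simp only: one_BijGroup_UNIV)
  next
    case (incl h)
    then show ?case using gens by auto
  next
    case (inv h)
    then have "h \<circ> h = id" using assms(1) by (auto simp: involutive_system_def)
    then show ?case using inv gens by (auto simp: inv_BijGroup_involution)
  next
    case (eng h1 h2)
    then have "bij h1" "bij h2"
      using generated_group_bij[OF assms(1)] by (auto simp: generated_group_def)
    then show ?case using eng comp by (simp only: mult_BijGroup_UNIV)
  qed
qed

section \<open>Invariants of the braid group action on systems\<close>

definition system_product :: "refl_system \<Rightarrow> vmap" where
  "system_product = (\<lambda>(S1, S2, S3). S1 \<circ> S2 \<circ> S3)"

lemma involution_cancel: "s \<circ> s = id \<Longrightarrow> s (s v) = v"
  by (metis comp_apply id_apply)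

lemma generated_group_mono:
  assumes "involutive_system (S1, S2, S3)" "involutive_system (T1, T2, T3)"
    and "S1 \<in> generated_group (T1, T2, T3)" "S2 \<in> generated_group (T1, T2, T3)"
      "S3 \<in> generated_group (T1, T2, T3)"
  shows "generated_group (S1, S2, S3) \<subseteq> generated_group (T1, T2, T3)"
  using assms
  by (intro generated_group_least) (auto intro: comp_in_generated_group id_in_generated_group)

text \<open>The product survives because R2 (R2 R1 R2) = R1 R2. The group survives because
  conjugating the new second entry by R2 gives R1 back.\<close>

lemma sys_braid1_invariants:
  assumes "involutive_system S"
  shows "involutive_system (sys_braid1 S)"
    and "system_product (sys_braid1 S) = system_product S"
    and "generated_group (sys_braid1 S) = generated_group S"
proof -
  obtain R1 R2 R3 where S: "S = (R1, R2, R3)" by (cases S)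
  have inv: "R1 \<circ> R1 = id" "R2 \<circ> R2 = id" "R3 \<circ> R3 = id"
    using assms by (auto simp: S involutive_system_def)
  note canc = inv[THEN involution_cancel]
  have braid: "sys_braid1 S = (R2, R2 \<circ> R1 \<circ> R2, R3)" by (simp add: S sys_braid1_def)
  show i: "involutive_system (sys_braid1 S)"
    unfolding braid by (auto simp: involutive_system_def fun_eq_iff canc)
  show "system_product (sys_braid1 S) = system_product S"
    unfolding braid by (auto simp: system_product_def S fun_eq_iff canc)
  have "R2 \<circ> (R2 \<circ> R1 \<circ> R2) \<circ> R2 = R1" by (auto simp: fun_eq_iff canc)
  then have "R1 \<in> generated_group (sys_braid1 S)"
    using i unfolding braid by (metis comp_in_generated_group generated_group_gens(1,2))
  then show "generated_group (sys_braid1 S) = generated_group S"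
    using i assms unfolding braid unfolding S
    by (intro equalityI generated_group_mono comp_in_generated_group generated_group_gens)
qed

lemma sys_braid2_invariants:
  assumes "involutive_system S"
  shows "involutive_system (sys_braid2 S)"
    and "system_product (sys_braid2 S) = system_product S"
    and "generated_group (sys_braid2 S) = generated_group S"
proof -
  obtain R1 R2 R3 where S: "S = (R1, R2, R3)" by (cases S)
  have inv: "R1 \<circ> R1 = id" "R2 \<circ> R2 = id" "R3 \<circ> R3 = id"
    using assms by (auto simp: S involutive_system_def)
  note canc = inv[THEN involution_cancel]
  have braid: "sys_braid2 S = (R1, R3, R3 \<circ> R2 \<circ> R3)" by (simp add: S sys_braid2_def)
  show i: "involutive_system (sys_braid2 S)"
    unfolding braid by (auto simp: involutive_system_def fun_eq_iff canc)
  show "system_product (sys_braid2 S) = system_product S"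
    unfolding braid by (auto simp: system_product_def S fun_eq_iff canc)
  have "R3 \<circ> (R3 \<circ> R2 \<circ> R3) \<circ> R3 = R2" by (auto simp: fun_eq_iff canc)
  then have "R2 \<in> generated_group (sys_braid2 S)"
    using i unfolding braid by (metis comp_in_generated_group generated_group_gens(2,3))
  then show "generated_group (sys_braid2 S) = generated_group S"
    using i assms unfolding braid unfolding S
    by (intro equalityI generated_group_mono comp_in_generated_group generated_group_gens)
qed

text \<open>Serves the backward steps of an orbit, which may a priori lead to arbitrary triples of
  maps. If s and s r s are involutions, then so is r.\<close>

lemma involutive_system_sys_braidD:
  assumes "involutive_system (sys_braid1 S) \<or> involutive_system (sys_braid2 S)"
  shows "involutive_system S"
proof -
  obtain R1 R2 R3 where S: "S = (R1, R2, R3)" by (cases S)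
  have conj: "r \<circ> r = id" if "s \<circ> s = id" "(s \<circ> r \<circ> s) \<circ> (s \<circ> r \<circ> s) = id" for r s :: vmap
  proof
    fix v
    have "s (r (s (s (r (s (s v)))))) = s v" using fun_cong[OF that(2), of "s v"] by simp
    then have "s (s (r (r v))) = s (s v)"  using that(1) by (simp add: involution_cancel)
    then show "(r \<circ> r) v = id v" using that(1) by (simp add: involution_cancel)
  qed
  show ?thesis
    using assms conj by (auto simp: S involutive_system_def sys_braid1_def sys_braid2_def)
qed

lemma system_orbit_invariants:
  assumes "T \<in> system_orbit S" and "involutive_system S"
  shows "involutive_system T \<and> system_product T = system_product S \<and>
    generated_group T = generated_group S"
proof -
  have "equivclp (\<lambda>a b. b = sys_braid1 a \<or> b = sys_braid2 a) S T"
    using assms(1) by (simp add: system_orbit_def)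
  then show ?thesis
  proof induction
    case base
    then show ?case using assms(2) by simp
  next
    case (step T U)
    then have "involutive_system T \<and> involutive_system U"
      using involutive_system_sys_braidD sys_braid1_invariants(1) sys_braid2_invariants(1) by blast
    then show ?case using step sys_braid1_invariants sys_braid2_invariants by metis
  qed
qed

section \<open>The form of a triple and its reflections\<close>

lemma form_expand:
  "form (x1, x2, x3) u v = 2 * u$1 * v$1 + 2 * u$2 * v$2 + 2 * u$3 * v$3
     + x1 * (u$1 * v$2 + u$2 * v$1) + x2 * (u$2 * v$3 + u$3 * v$2) + x3 * (u$1 * v$3 + u$3 * v$1)"
  by (simp add: form_def gram_def sum_3 algebra_simps)

lemma axis_components:
  "(axis 1 1 :: real^3) $ 1 = 1" "(axis 1 1 :: real^3) $ 2 = 0" "(axis 1 1 :: real^3) $ 3 = 0"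
  "(axis 2 1 :: real^3) $ 1 = 0" "(axis 2 1 :: real^3) $ 2 = 1" "(axis 2 1 :: real^3) $ 3 = 0"
  "(axis 3 1 :: real^3) $ 1 = 0" "(axis 3 1 :: real^3) $ 2 = 0" "(axis 3 1 :: real^3) $ 3 = 1"
  by (simp_all add: axis_def)

lemma form_axis_self: "form x (axis i 1) (axis i 1) = 2"
  using exhaust_3[of i] by (cases x) (auto simp: form_expand axis_components)

lemma linear_reflect: "linear (reflect x i)"
  by (cases x, intro linearI) (auto simp: reflect_def form_expand algebra_simps)

lemma linear_reflection_along: "linear (reflection_along n)"
  by (intro linearI)
    (simp_all add: reflection_along_def inner_add_right inner_scaleR_right add_divide_distrib
      scaleR_add_left algebra_simps)

lemma reflection_along_scaleR: "c \<noteq> 0 \<Longrightarrow> reflection_along (c *\<^sub>R n) = reflection_along n"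
  by (rule ext) (simp add: reflection_along_def)

lemma reflection_along_0: "reflection_along 0 = id"
  by (rule ext) (simp add: reflection_along_def)

lemma reflection_along_involution: "reflection_along n \<circ> reflection_along n = id"
  by (cases "n = 0")
    (auto simp: fun_eq_iff reflection_along_def inner_diff_right inner_scaleR_right
      scaleR_diff_left diff_divide_distrib)

lemma inner_reflection_along: "reflection_along n u \<bullet> reflection_along n v = u \<bullet> v"
  by (cases "n = 0")
    (auto simp: reflection_along_def inner_diff_left inner_diff_right inner_commute algebra_simps)

text \<open>Turns a braid move on reflections into a change of vectors. It rests on the reflection
  being self-adjoint and preserving norms.\<close>

lemma reflection_along_image:
  "reflection_along (reflection_along n m) = reflection_along n \<circ> reflection_along m \<circ> reflection_along n"
proof
  fix v
  let ?R = "reflection_along n"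
  have v: "?R (?R v) = v" by (rule involution_cancel[OF reflection_along_involution])
  have "?R m \<bullet> v = m \<bullet> ?R v" by (metis v inner_reflection_along)
  moreover have "?R m \<bullet> ?R m = m \<bullet> m" by (rule inner_reflection_along)
  ultimately show "reflection_along (?R m) v = (?R \<circ> reflection_along m \<circ> ?R) v"
    using linear_reflection_along[of n]
    by (simp add: reflection_along_def[of m] reflection_along_def[of "?R m"] linear_diff linear_scale v)
qed

section \<open>Transport of reflections and generated groups\<close>

lemma isometry_linear: "isometry_to_euclidean x \<phi> \<Longrightarrow> linear \<phi>"
  and isometry_bij: "isometry_to_euclidean x \<phi> \<Longrightarrow> bij \<phi>"
  and isometry_inner: "isometry_to_euclidean x \<phi> \<Longrightarrow> \<phi> u \<bullet> \<phi> v = form x u v"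
  by (auto simp: isometry_to_euclidean_def)

lemma transport_apply: "bij \<phi> \<Longrightarrow> transport \<phi> g (\<phi> v) = \<phi> (g v)"
  by (simp add: transport_def the_inv_f_f bij_is_inj)

text \<open>For bijective \<phi> the relation \<open>h \<circ> \<phi> = \<phi> \<circ> g\<close>
  determines h, so transports are recognised by this relation instead of by handling
  \<open>the_inv\<close>.\<close>

lemma transport_eqI:
  assumes "bij \<phi>" "\<And>v. h (\<phi> v) = \<phi> (g v)" shows "transport \<phi> g = h"
proof
  fix w
  obtain v where "w = \<phi> v" using assms(1) by (meson bij_pointE)
  then show "transport \<phi> g w = h w" by (simp add: transport_apply assms)
qed

lemma transport_comp: "bij \<phi> \<Longrightarrow> transport \<phi> (f \<circ> g) = transport \<phi> f \<circ> transport \<phi> g"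
  by (intro transport_eqI) (simp_all add: transport_apply)

lemma transport_id: "bij \<phi> \<Longrightarrow> transport \<phi> id = id"
  by (intro transport_eqI) simp_all

lemma transport_transport:
  "bij \<phi> \<Longrightarrow> bij \<psi> \<Longrightarrow> transport \<psi> (transport \<phi> g) = transport (\<psi> \<circ> \<phi>) g"
  by (intro transport_eqI[symmetric]) (simp_all add: transport_apply bij_comp)

lemma transport_reflect:
  assumes "isometry_to_euclidean x \<phi>"
  shows "transport \<phi> (reflect x i) = reflection_along (\<phi> (axis i 1))"
  using assms form_axis_self[of x i]
  by (intro transport_eqI)
    (simp_all add: isometry_bij isometry_inner reflection_along_def reflect_def linear_diff
      linear_scale isometry_linear)

lemma isometry_axis_nonzero:
  assumes "isometry_to_euclidean x \<phi>" shows "\<phi> (axis i 1) \<noteq> 0"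
  using isometry_inner[OF assms, of "axis i 1" "axis i 1"] by (auto simp: form_axis_self)

lemma transport_system_reflections:
  assumes "isometry_to_euclidean x \<phi>"
  shows "transport_system \<phi> (reflections x) = (reflection_along (\<phi> (axis 1 1)),
    reflection_along (\<phi> (axis 2 1)), reflection_along (\<phi> (axis 3 1)))"
  by (simp add: transport_system_def reflections_def transport_reflect[OF assms])

lemma involutive_reflection_along:
  "involutive_system (reflection_along l, reflection_along m, reflection_along n)"
  by (simp add: involutive_system_def reflection_along_involution)

lemma involutive_reflections: "involutive_system (reflections x)"
proof -
  have "reflect x i \<circ> reflect x i = id" for i
    using exhaust_3[of i] by (cases x)
      (auto simp: fun_eq_iff vec_eq_iff forall_3 reflect_def form_expand axis_components)
  then show ?thesis by (simp add: involutive_system_def reflections_def)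
qed

lemma involutive_transport_system:
  assumes "bij \<phi>" "involutive_system S" shows "involutive_system (transport_system \<phi> S)"
proof (cases S)
  case (fields S1 S2 S3)
  then show ?thesis
    using assms by (auto simp: involutive_system_def transport_system_def transport_id
        transport_comp[symmetric])
qed

text \<open>Conjugation by a bijection is an endomorphism of the group of all bijections, and
  homomorphisms map generated subgroups onto generated subgroups.\<close>

lemma generated_group_transport_system:
  assumes "bij \<phi>" "involutive_system S"
  shows "generated_group (transport_system \<phi> S) = transport \<phi> ` generated_group S"
proof (cases S)
  case (fields S1 S2 S3)
  have bij: "bij (transport \<phi> f)" if "bij f" for f
    using assms(1) that by (simp add: transport_def bij_comp bij_betw_the_inv_into)
  interpret group_hom "BijGroup UNIV" "BijGroup UNIV" "transport \<phi>"
    using assms(1) bij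
    by (auto simp: group_hom_def group_hom_axioms_def group_BijGroup hom_def carrier_BijGroup_UNIV
        mult_BijGroup_UNIV transport_comp)
  have "{S1, S2, S3} \<subseteq> carrier (BijGroup UNIV)"
    using assms(2) by (auto simp: carrier_BijGroup_UNIV involutive_system_def fields intro: o_bij)
  then show ?thesis
    using generate_img[of "{S1, S2, S3}"] by (simp add: fields transport_system_def generated_group_def)
qed

lemma identifies_iff:
  "identifies \<phi> x W \<longleftrightarrow>
     isometry_to_euclidean x \<phi> \<and> generated_group (transport_system \<phi> (reflections x)) = W"
  by (auto simp: identifies_def generated_group_transport_system isometry_bij involutive_reflections)

section \<open>Orbits of triples\<close>

definition triple_step :: "triple \<Rightarrow> triple \<Rightarrow> bool" where
  "triple_step a b \<longleftrightarrow> b = braid1 a \<or> b = braid2 a \<or> b \<in> sign_changes a"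

lemma isometry_change_of_basis:
  assumes "isometry_to_euclidean a \<phi>" "linear A" "bij A" "\<And>u v. form a (A u) (A v) = form b u v"
  shows "isometry_to_euclidean b (\<phi> \<circ> A)"
  using assms by (auto simp: isometry_to_euclidean_def bij_comp linear_compose)

lemma isometry_change_of_basis_inv:
  assumes "isometry_to_euclidean b \<phi>" "linear A" "bij A" "\<And>u v. form a (A u) (A v) = form b u v"
  shows "isometry_to_euclidean a (\<phi> \<circ> inv_into UNIV A)"
proof (rule isometry_change_of_basis[OF assms(1)])
  show "linear (inv_into UNIV A)" using assms by (simp add: bij_is_inj inj_linear_imp_inv_linear)
  show "bij (inv_into UNIV A)" using assms by (simp add: bij_imp_bij_inv)
  show "form b (inv_into UNIV A u) (inv_into UNIV A v) = form a u v" for u v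
    using assms(4)[of "inv_into UNIV A u" "inv_into UNIV A v"] assms(3) by (simp add: bij_is_surj surj_f_inv_f)
qed

lemma isometry_reflect:
  assumes "isometry_to_euclidean x \<phi>"
  shows "reflection_along (\<phi> (axis i 1)) (\<phi> v) = \<phi> (reflect x i v)"
  using transport_apply[OF isometry_bij[OF assms]] transport_reflect[OF assms] by metis

text \<open>The map \<open>A\<close> sends the basis vectors of b to vectors of the space of a with
  the Gram matrix of b, and it does not depend on \<phi>. Reflections in these new vectors form the
  braid image of the old system, or the old system itself for a sign change.\<close>

lemma triple_step_change_of_basis:
  assumes "triple_step a b"
  obtains A where "linear A" "bij A" "\<And>u v. form a (A u) (A v) = form b u v"
    and "\<And>\<phi> S. isometry_to_euclidean a \<phi> \<Longrightarrow> S = transport_system \<phi> (reflections a) \<Longrightarrow>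
      transport_system (\<phi> \<circ> A) (reflections b) \<in> {S, sys_braid1 S, sys_braid2 S}"
proof -
  obtain x1 x2 x3 where a: "a = (x1, x2, x3)" by (cases a)
  have orbit: "transport_system (\<phi> \<circ> A) (reflections b) = (reflection_along (\<phi> (A (axis 1 1))),
      reflection_along (\<phi> (A (axis 2 1))), reflection_along (\<phi> (A (axis 3 1))))"
    if "isometry_to_euclidean a \<phi>" "linear A" "bij A" "\<And>u v. form a (A u) (A v) = form b u v" for A \<phi>
    using transport_system_reflections[OF isometry_change_of_basis[OF that]] by simp
  consider "b = braid1 a" | "b = braid2 a" | "b \<in> sign_changes a"
    using assms by (auto simp: triple_step_def)
  then show thesis
  proof cases
    case 1
    \<comment> \<open>Sends e1, e2, e3 to e2, e1 - x1 e2, e3, where the second vector is e1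
      reflected in e2.\<close>
    define A :: vmap where "A = (\<lambda>v. vector [v$2, v$1 - x1 * v$2, v$3])"
    have lin: "linear A"
      by (intro linearI) (simp_all add: A_def vec_eq_iff forall_3 algebra_simps)
    have bij: "bij A"
      by (rule o_bij[where g = "\<lambda>v. vector [v$2 + x1 * v$1, v$1, v$3]"])
        (simp_all add: A_def fun_eq_iff vec_eq_iff forall_3)
    have form: "form a (A u) (A v) = form b u v" for u v
      by (simp add: 1 a braid1_def form_expand A_def algebra_simps)
    have ax: "A (axis 1 1) = axis 2 1" "A (axis 2 1) = reflect a 2 (axis 1 1)"
      "A (axis 3 1) = axis 3 1"
      by (simp_all add: A_def vec_eq_iff forall_3 axis_components reflect_def a form_expand)
    show thesis
    proof (rule that[OF lin bij form])
      fix \<phi> S assume iso: "isometry_to_euclidean a \<phi>" and S: "S = transport_system \<phi> (reflections a)"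
      have "transport_system (\<phi> \<circ> A) (reflections b) = sys_braid1 S"
        unfolding orbit[OF iso lin bij form] S transport_system_reflections[OF iso] ax
        by (simp add: sys_braid1_def reflection_along_image flip: isometry_reflect[OF iso])
      then show "transport_system (\<phi> \<circ> A) (reflections b) \<in> {S, sys_braid1 S, sys_braid2 S}"
        by simp
    qed
  next
    case 2
    \<comment> \<open>Sends e1, e2, e3 to e1, e3, e2 - x2 e3, where the last vector is e2 reflected
      in e3.\<close>
    define A :: vmap where "A = (\<lambda>v. vector [v$1, v$3, v$2 - x2 * v$3])"
    have lin: "linear A"
      by (intro linearI) (simp_all add: A_def vec_eq_iff forall_3 algebra_simps)
    have bij: "bij A"
      by (rule o_bij[where g = "\<lambda>v. vector [v$1, v$3 + x2 * v$2, v$2]"])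
        (simp_all add: A_def fun_eq_iff vec_eq_iff forall_3)
    have form: "form a (A u) (A v) = form b u v" for u v
      by (simp add: 2 a braid2_def form_expand A_def algebra_simps)
    have ax: "A (axis 1 1) = axis 1 1" "A (axis 2 1) = axis 3 1"
      "A (axis 3 1) = reflect a 3 (axis 2 1)"
      by (simp_all add: A_def vec_eq_iff forall_3 axis_components reflect_def a form_expand)
    show thesis
    proof (rule that[OF lin bij form])
      fix \<phi> S assume iso: "isometry_to_euclidean a \<phi>" and S: "S = transport_system \<phi> (reflections a)"
      have "transport_system (\<phi> \<circ> A) (reflections b) = sys_braid2 S"
        unfolding orbit[OF iso lin bij form] S transport_system_reflections[OF iso] ax
        by (simp add: sys_braid2_def reflection_along_image flip: isometry_reflect[OF iso])
      then show "transport_system (\<phi> \<circ> A) (reflections b) \<in> {S, sys_braid1 S, sys_braid2 S}"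
        by simp
    qed
  next
    case 3
    \<comment> \<open>Changing the signs of two coordinates of the triple amounts to negating the
      one basis vector that both products share.\<close>
    then obtain s1 s2 s3 :: real where s: "s1 \<in> {1, -1}" "s2 \<in> {1, -1}" "s3 \<in> {1, -1}"
      and b: "b = (s1 * s2 * x1, s2 * s3 * x2, s1 * s3 * x3)"
    proof -
      consider "b = (- x1, - x2, x3)" | "b = (x1, - x2, - x3)" | "b = (- x1, x2, - x3)"
        using 3 by (auto simp: a sign_changes_def)
      then show thesis
        by cases (use that[of 1 "-1" 1] that[of 1 1 "-1"] that[of "-1" 1 1] in simp_all)
    qed
    then have ss: "s1 * s1 = 1" "s2 * s2 = 1" "s3 * s3 = 1" by auto
    define A :: vmap where "A = (\<lambda>v. vector [s1 * v$1, s2 * v$2, s3 * v$3])"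
    have lin: "linear A"
      by (intro linearI) (simp_all add: A_def vec_eq_iff forall_3 algebra_simps)
    have "A \<circ> A = id"
      using s by (auto simp: A_def fun_eq_iff vec_eq_iff forall_3)
    then have bij: "bij A" by (simp add: o_bij)
    have form: "form a (A u) (A v) = form b u v" for u v
      using s by (auto simp: a b form_expand A_def algebra_simps)
    have ax: "A (axis 1 1) = s1 *\<^sub>R axis 1 1" "A (axis 2 1) = s2 *\<^sub>R axis 2 1"
      "A (axis 3 1) = s3 *\<^sub>R axis 3 1"
      by (simp_all add: A_def vec_eq_iff forall_3 axis_components)
    show thesis
    proof (rule that[OF lin bij form])
      fix \<phi> S assume iso: "isometry_to_euclidean a \<phi>" and S: "S = transport_system \<phi> (reflections a)"
      have "s1 \<noteq> 0" "s2 \<noteq> 0" "s3 \<noteq> 0" using s by auto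
      then have "transport_system (\<phi> \<circ> A) (reflections b) = S"
        unfolding orbit[OF iso lin bij form] S transport_system_reflections[OF iso] ax
          linear_scale[OF isometry_linear[OF iso]]
        by (simp add: reflection_along_scaleR)
      then show "transport_system (\<phi> \<circ> A) (reflections b) \<in> {S, sys_braid1 S, sys_braid2 S}"
        by simp
    qed
  qed
qed

lemma system_orbit_refl: "S \<in> system_orbit S"
  by (simp add: system_orbit_def)

lemma system_orbit_step:
  assumes "T \<in> system_orbit S"
    and "U \<in> {T, sys_braid1 T, sys_braid2 T} \<or> T \<in> {U, sys_braid1 U, sys_braid2 U}"
  shows "U \<in> system_orbit S"
proof (cases "U = T")
  case False
  let ?R = "\<lambda>a b. b = sys_braid1 a \<or> b = sys_braid2 a"
  have "?R T U \<or> ?R U T" using assms(2) False by auto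
  with assms(1) show ?thesis
    by (auto simp: system_orbit_def intro: equivclp_into_equivclp)
qed (use assms(1) in simp)

text \<open>Lifts a path of triples to a path of systems in one fixed Euclidean space: the isometry
  is corrected by a basis change at every step, and the transported system either stays or makes a
  braid move.\<close>

lemma triple_orbit_isometry:
  assumes "y \<in> triple_orbit x" and iso: "isometry_to_euclidean x \<phi>"
  obtains \<psi> where "isometry_to_euclidean y \<psi>"
    and "transport_system \<psi> (reflections y) \<in> system_orbit (transport_system \<phi> (reflections x))"
proof -
  have "equivclp triple_step x y"
    using assms(1) by (simp add: triple_orbit_def triple_step_def[abs_def])
  then have "\<exists>\<psi>. isometry_to_euclidean y \<psi> \<and>
    transport_system \<psi> (reflections y) \<in> system_orbit (transport_system \<phi> (reflections x))"
  proof induction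
    case base
    then show ?case using iso system_orbit_refl by blast
  next
    case (step y z)
    then obtain \<psi> where \<psi>: "isometry_to_euclidean y \<psi>"
      "transport_system \<psi> (reflections y) \<in> system_orbit (transport_system \<phi> (reflections x))"
      by blast
    from step(2) show ?case
    proof
      assume "triple_step y z"
      then obtain A where A: "linear A" "bij A" "\<And>u v. form y (A u) (A v) = form z u v"
        and T: "\<And>\<phi> S. isometry_to_euclidean y \<phi> \<Longrightarrow> S = transport_system \<phi> (reflections y) \<Longrightarrow>
          transport_system (\<phi> \<circ> A) (reflections z) \<in> {S, sys_braid1 S, sys_braid2 S}"
        by (rule triple_step_change_of_basis) blast
      show ?thesis
        using isometry_change_of_basis[OF \<psi>(1) A] system_orbit_step[OF \<psi>(2)] T[OF \<psi>(1) refl]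
        by blast
    next
      assume "triple_step z y"
      then obtain A where A: "linear A" "bij A" "\<And>u v. form z (A u) (A v) = form y u v"
        and T: "\<And>\<phi> S. isometry_to_euclidean z \<phi> \<Longrightarrow> S = transport_system \<phi> (reflections z) \<Longrightarrow>
          transport_system (\<phi> \<circ> A) (reflections y) \<in> {S, sys_braid1 S, sys_braid2 S}"
        by (rule triple_step_change_of_basis) blast
      \<comment> \<open>A step taken backwards: the basis change goes from z to y, so its inverse
        corrects the isometry, and the system of y is a braid image of the new one.\<close>
      have iso: "isometry_to_euclidean z (\<psi> \<circ> inv_into UNIV A)"
        by (rule isometry_change_of_basis_inv[OF \<psi>(1) A])
      moreover have "\<psi> \<circ> inv_into UNIV A \<circ> A = \<psi>"
        using A(2) by (simp add: fun_eq_iff bij_is_inj)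
      ultimately show ?thesis
        using system_orbit_step[OF \<psi>(2)] T[OF iso refl] by (metis (no_types, lifting))
    qed
  qed
  then show thesis using that by blast
qed

lemma identifies_triple_orbit:
  assumes "y \<in> triple_orbit x" and "identifies \<phi> x W"
  shows "\<exists>\<psi>. identifies \<psi> y W"
proof -
  have iso: "isometry_to_euclidean x \<phi>" using assms(2) by (simp add: identifies_iff)
  obtain \<psi> where \<psi>: "isometry_to_euclidean y \<psi>"
    "transport_system \<psi> (reflections y) \<in> system_orbit (transport_system \<phi> (reflections x))"
    using triple_orbit_isometry[OF assms(1) iso] .
  have "involutive_system (transport_system \<phi> (reflections x))"
    by (simp add: involutive_transport_system isometry_bij[OF iso] involutive_reflections)
  then show ?thesis
    using system_orbit_invariants[OF \<psi>(2)] \<psi>(1) assms(2) by (auto simp: identifies_iff)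
qed

section \<open>Separating the orbits\<close>

text \<open>A cubic of Markov type; the determinant of \<open>gram x\<close> is 8 - 2 *
  \<open>triple_invariant x\<close>.\<close>

definition triple_invariant :: "triple \<Rightarrow> real" where
  "triple_invariant = (\<lambda>(x1, x2, x3). x1\<^sup>2 + x2\<^sup>2 + x3\<^sup>2 - x1 * x2 * x3)"

lemma triple_orbit_invariant:
  assumes "y \<in> triple_orbit x" shows "triple_invariant y = triple_invariant x"
proof -
  have step: "triple_invariant b = triple_invariant a" if "triple_step a b" for a b
    using that by (cases a)
      (auto simp: triple_step_def triple_invariant_def braid1_def braid2_def sign_changes_def
        power2_eq_square algebra_simps)
  have "equivclp triple_step x y"
    using assms(1) by (simp add: triple_orbit_def triple_step_def[abs_def])
  then show ?thesis by induction (auto dest: step)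
qed

lemma linear_system_product_reflections: "linear (system_product (reflections x))"
  by (simp add: system_product_def reflections_def linear_compose linear_reflect)

lemma trace_system_product:
  "trace (matrix (system_product (reflections x))) = triple_invariant x - 3"
  by (cases x)
    (simp add: system_product_def reflections_def trace_def sum_3 matrix_def reflect_def form_expand
      axis_components triple_invariant_def power2_eq_square algebra_simps)

text \<open>Transport is conjugation by a linear bijection, and trace (M N) = trace (N M).\<close>

lemma trace_transport:
  assumes "linear \<phi>" "bij \<phi>" "linear g"
  shows "trace (matrix (transport \<phi> g)) = trace (matrix g)"
proof -
  have lin: "linear (inv_into UNIV \<phi>)"
    using assms by (simp add: bij_is_inj inj_linear_imp_inv_linear)
  have "transport \<phi> g = \<phi> \<circ> (g \<circ> inv_into UNIV \<phi>)"
    using assms by (intro transport_eqI) (simp_all add: bij_is_inj)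
  then have "trace (matrix (transport \<phi> g)) = trace (matrix \<phi> ** matrix (g \<circ> inv_into UNIV \<phi>))"
    using assms lin by (simp add: matrix_compose linear_compose)
  also have "\<dots> = trace (matrix (g \<circ> inv_into UNIV \<phi>) ** matrix \<phi>)" by (rule trace_mul_sym)
  also have "\<dots> = trace (matrix (g \<circ> inv_into UNIV \<phi> \<circ> \<phi>))"
    using assms lin by (metis matrix_compose linear_compose)
  also have "g \<circ> inv_into UNIV \<phi> \<circ> \<phi> = g"
    using assms by (simp add: fun_eq_iff bij_is_inj)
  finally show ?thesis .
qed

lemma system_product_transport_system:
  "bij \<phi> \<Longrightarrow> system_product (transport_system \<phi> S) = transport \<phi> (system_product S)"
  by (cases S) (simp add: system_product_def transport_system_def transport_comp)

lemma trace_transport_system_product: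
  assumes "isometry_to_euclidean x \<phi>"
  shows "linear (system_product (transport_system \<phi> (reflections x)))"
    and "trace (matrix (system_product (transport_system \<phi> (reflections x)))) = triple_invariant x - 3"
proof -
  show "linear (system_product (transport_system \<phi> (reflections x)))"
    by (simp add: transport_system_reflections[OF assms] system_product_def linear_compose
        linear_reflection_along)
  show "trace (matrix (system_product (transport_system \<phi> (reflections x)))) = triple_invariant x - 3"
    using assms
    by (simp add: system_product_transport_system isometry_bij isometry_linear trace_transport
        linear_system_product_reflections trace_system_product)
qed

lemma transport_system_transport_system:
  "bij \<phi> \<Longrightarrow> bij \<psi> \<Longrightarrow> transport_system \<psi> (transport_system \<phi> S) = transport_system (\<psi> \<circ> \<phi>) S"
  by (cases S) (simp add: transport_system_def transport_transport)

lemma same_choice_imp_invariant_eq: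
  assumes iso: "isometry_to_euclidean x \<phi>" "isometry_to_euclidean y \<psi>"
    and "same_choice (transport_system \<phi> (reflections x)) (transport_system \<psi> (reflections y))"
  shows "triple_invariant x = triple_invariant y"
proof -
  obtain g where g: "orthogonal_transformation g"
    "transport_system g (transport_system \<psi> (reflections y)) \<in>
       system_orbit (transport_system \<phi> (reflections x))"
    using assms(3) by (auto simp: same_choice_def)
  have "system_product (transport_system g (transport_system \<psi> (reflections y))) =
      system_product (transport_system \<phi> (reflections x))"
    using system_orbit_invariants[OF g(2)] iso(1)
    by (simp add: involutive_transport_system isometry_bij involutive_reflections)
  then have "trace (matrix (transport g (system_product (transport_system \<psi> (reflections y))))) =
      triple_invariant x - 3"
    using g(1) trace_transport_system_product[OF iso(1)]
    by (simp add: system_product_transport_system orthogonal_transformation_bij)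
  then show ?thesis
    using trace_transport_system_product[OF iso(2)] g(1)
    by (simp add: trace_transport orthogonal_transformation_bij orthogonal_transformation_linear)
qed

text \<open>Following the orbit from x produces some isometry \<omega> for y, in general different
  from the given \<psi>. Both pull the Euclidean product back to the same form, so
  \<open>\<omega> \<circ> inv_into UNIV \<psi>\<close> is orthogonal and serves as the conjugating
  isometry.\<close>

lemma triple_orbit_imp_same_choice:
  assumes iso: "isometry_to_euclidean x \<phi>" "isometry_to_euclidean y \<psi>"
    and "y \<in> triple_orbit x"
  shows "same_choice (transport_system \<phi> (reflections x)) (transport_system \<psi> (reflections y))"
proof -
  obtain \<omega> where \<omega>: "isometry_to_euclidean y \<omega>"
    "transport_system \<omega> (reflections y) \<in> system_orbit (transport_system \<phi> (reflections x))"
    using triple_orbit_isometry[OF assms(3) iso(1)] .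
  define g where "g = \<omega> \<circ> inv_into UNIV \<psi>"
  note bij = isometry_bij[OF iso(2)] isometry_bij[OF \<omega>(1)]
  note lin = isometry_linear[OF iso(2)] isometry_linear[OF \<omega>(1)]
  have "linear g"
    unfolding g_def using bij lin by (simp add: linear_compose bij_is_inj inj_linear_imp_inv_linear)
  moreover have "g u \<bullet> g v = u \<bullet> v" for u v
    using isometry_inner[OF \<omega>(1), of "inv_into UNIV \<psi> u" "inv_into UNIV \<psi> v"]
      isometry_inner[OF iso(2), of "inv_into UNIV \<psi> u" "inv_into UNIV \<psi> v"] bij(1)
    by (simp add: g_def bij_is_surj surj_f_inv_f)
  ultimately have g: "orthogonal_transformation g"
    by (simp add: orthogonal_transformation_def)
  moreover have "g \<circ> \<psi> = \<omega>"
    using bij(1) by (simp add: g_def fun_eq_iff bij_is_inj)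
  then have "transport_system g (transport_system \<psi> (reflections y)) =
      transport_system \<omega> (reflections y)"
    using bij(1) orthogonal_transformation_bij[OF g] by (simp add: transport_system_transport_system)
  ultimately show ?thesis using \<omega>(2) by (auto simp: same_choice_def)
qed

section \<open>Recognising the symmetry group of a polyhedron\<close>

text \<open>Strict convexity of the ball: every other point p on the sphere has x \<bullet> p < r^2,
  so a hull of such points stays in an open half space that misses x.\<close>

lemma convex_hull_sphere_imp_vertex:
  fixes x :: "'a::real_inner"
  assumes "x \<in> convex hull V" and "\<And>v. v \<in> V \<Longrightarrow> norm v = r" and "norm x = r"
  shows "x \<in> V"
proof (rule ccontr)
  assume "x \<notin> V"
  have "V \<subseteq> {p. x \<bullet> p < r\<^sup>2}"
  proof
    fix v assume "v \<in> V"
    then have "0 < (x - v) \<bullet> (x - v)" using \<open>x \<notin> V\<close> by auto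
    also have "\<dots> = 2 * r\<^sup>2 - 2 * (x \<bullet> v)"
      using power2_norm_eq_inner[of x] power2_norm_eq_inner[of v] assms(2)[OF \<open>v \<in> V\<close>] assms(3)
      by (simp add: inner_diff_left inner_diff_right inner_commute)
    finally show "v \<in> {p. x \<bullet> p < r\<^sup>2}" by simp
  qed
  then have "convex hull V \<subseteq> {p. x \<bullet> p < r\<^sup>2}"
    by (intro hull_minimal convex_halfspace_lt)
  then show False
    using assms(1,3) by (auto simp flip: power2_norm_eq_inner)
qed

text \<open>A symmetry fixes the centre: the ball of radius \<open>r\<close> about the image of 0 still contains
  all vertices, which confines the hull to a half space avoiding 0 unless that image is 0.\<close>

lemma symmetries_convex_hull_orthogonal:
  assumes f: "f \<in> symmetries (convex hull V)"
    and 0: "0 \<in> convex hull V" and r: "\<And>v. v \<in> V \<Longrightarrow> norm v = r"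
  shows "orthogonal_transformation f" and "\<And>v. v \<in> V \<Longrightarrow> f v \<in> V"
proof -
  have dist: "dist (f u) (f v) = dist u v" and image: "f ` (convex hull V) = convex hull V" for u v
    using f by (auto simp: symmetries_def)
  have "convex hull V \<subseteq> cball 0 r"
    using r by (intro hull_minimal) auto
  define c where "c = f 0"
  have "V \<subseteq> {p. c \<bullet> p \<ge> (c \<bullet> c) / 2}"
  proof
    fix v assume v: "v \<in> V"
    then have "v \<in> f ` (convex hull V)" by (simp add: image hull_inc)
    then obtain p where "p \<in> convex hull V" "v = f p" by auto
    then have "dist v c = norm p" and "norm p \<le> r"
      using \<open>convex hull V \<subseteq> cball 0 r\<close> by (auto simp: c_def dist)
    then have "(norm (v - c))\<^sup>2 \<le> (norm v)\<^sup>2"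
      using r[OF v] by (simp add: dist_norm power_mono)
    then show "v \<in> {p. c \<bullet> p \<ge> (c \<bullet> c) / 2}"
      by (simp add: power2_norm_eq_inner inner_diff_left inner_diff_right inner_commute)
  qed
  then have "convex hull V \<subseteq> {p. c \<bullet> p \<ge> (c \<bullet> c) / 2}"
    by (intro hull_minimal convex_halfspace_ge)
  with 0 have "c \<bullet> c \<le> 0" by auto
  then have "f 0 = 0" by (simp add: c_def flip: power2_norm_eq_inner)
  then show orth: "orthogonal_transformation f"
    by (simp add: orthogonal_transformation_isometry dist)
  show "f v \<in> V" if "v \<in> V" for v
  proof (rule convex_hull_sphere_imp_vertex[where r = r])
    show "f v \<in> convex hull V" using that image hull_inc[OF that] by blast
  qed (use that r orth in \<open>auto simp: orthogonal_transformation_norm\<close>)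
qed

lemma orthogonal_reflection_along: "orthogonal_transformation (reflection_along n)"
  by (simp add: orthogonal_transformation_def linear_reflection_along inner_reflection_along)

text \<open>The mirror consists of the points having equal inner products with u and v; for equal
  norms it is their perpendicular bisector.\<close>

lemma reflection_along_diff:
  assumes "u \<bullet> u = v \<bullet> v" shows "reflection_along (u - v) u = v"
proof (cases "u = v")
  case False
  then have "(u - v) \<bullet> (u - v) \<noteq> 0" by simp
  moreover have "2 * ((u - v) \<bullet> u) = (u - v) \<bullet> (u - v)"
    using assms by (simp add: inner_diff_left inner_diff_right inner_commute)
  ultimately show ?thesis by (simp add: reflection_along_def)
qed (simp add: reflection_along_0)

lemma reflection_along_orthogonal: "n \<bullet> v = 0 \<Longrightarrow> reflection_along n v = v"
  by (simp add: reflection_along_def)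

lemma left_inverse_in_generated_group:
  assumes "involutive_system (S1, S2, S3)" and "w \<in> generated_group (S1, S2, S3)"
  obtains w' where "w' \<in> generated_group (S1, S2, S3)" "w' \<circ> w = id"
proof -
  interpret group "BijGroup UNIV" by (rule group_BijGroup)
  let ?w' = "inv\<^bsub>BijGroup UNIV\<^esub> w"
  have sub: "{S1, S2, S3} \<subseteq> carrier (BijGroup UNIV)"
    using assms(1) by (auto simp: carrier_BijGroup_UNIV involutive_system_def intro: o_bij)
  then have w': "?w' \<in> generated_group (S1, S2, S3)"
    using generate_m_inv_closed[OF sub] assms(2) by (simp add: generated_group_def)
  have "w \<in> carrier (BijGroup UNIV)"
    using generated_group_bij[OF assms] by (simp add: carrier_BijGroup_UNIV)
  then have "?w' \<circ> w = id"
    using l_inv[of w] generated_group_bij[OF assms] generated_group_bij[OF assms(1) w']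
    by (simp only: mult_BijGroup_UNIV one_BijGroup_UNIV)
  with w' show thesis by (rule that)
qed

text \<open>A symmetry is brought to the identity by moving the images of the vertices \<open>a\<close>, \<open>b\<close>, \<open>c\<close>
  back one after the other; a reflection along \<open>u - b\<close> moves \<open>u\<close> to \<open>b\<close> and fixes every point
  equidistant from both.\<close>

lemma generated_group_eq_symmetries:
  fixes l m n :: "real^3"
  defines "G \<equiv> generated_group (reflection_along l, reflection_along m, reflection_along n)"
  assumes 0: "0 \<in> convex hull V" and r: "\<And>v. v \<in> V \<Longrightarrow> norm v = r"
    and stable: "\<And>k v. k \<in> {l, m, n} \<Longrightarrow> v \<in> V \<Longrightarrow> reflection_along k v \<in> V"
    and abc: "a \<in> V" "b \<in> V" "c \<in> V"
    and basis: "\<And>v. v \<bullet> a = 0 \<Longrightarrow> v \<bullet> b = 0 \<Longrightarrow> v \<bullet> c = 0 \<Longrightarrow> v = 0"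
    and trans_a: "\<And>u. u \<in> V \<Longrightarrow> \<exists>w\<in>G. w u = a"
    and trans_b: "\<And>u. u \<in> V \<Longrightarrow> u \<noteq> b \<Longrightarrow> u \<bullet> a = b \<bullet> a \<Longrightarrow> reflection_along (u - b) \<in> G"
    and trans_c: "\<And>u. u \<in> V \<Longrightarrow> u \<noteq> c \<Longrightarrow> u \<bullet> a = c \<bullet> a \<Longrightarrow> u \<bullet> b = c \<bullet> b \<Longrightarrow>
      reflection_along (u - c) \<in> G"
  shows "G = symmetries (convex hull V)"
proof
  note inv = involutive_reflection_along[of l m n]
  have comp: "f \<circ> g \<in> G" if "f \<in> G" "g \<in> G" for f g
    using comp_in_generated_group[OF inv] that by (simp add: G_def)
  have reflection_symmetry: "reflection_along k \<in> symmetries (convex hull V)" if "k \<in> {l, m, n}" for k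
  proof -
    have "reflection_along k ` V \<subseteq> V" using stable[OF that] by auto
    moreover have "V \<subseteq> reflection_along k ` V"
      using stable[OF that] involution_cancel[OF reflection_along_involution] by (metis imageI subsetI)
    ultimately have "reflection_along k ` (convex hull V) = convex hull V"
      by (simp add: convex_hull_linear_image linear_reflection_along)
    then show ?thesis
      using orthogonal_reflection_along[of k]
      by (simp add: symmetries_def orthogonal_transformation_isometry)
  qed
  show "G \<subseteq> symmetries (convex hull V)"
    unfolding G_def
  proof (rule generated_group_least[OF inv])
    show "id \<in> symmetries (convex hull V)" by (simp add: symmetries_def)
    show "f \<circ> g \<in> symmetries (convex hull V)"
      if "f \<in> symmetries (convex hull V)" "g \<in> symmetries (convex hull V)" for f g
      using that by (simp add: symmetries_def flip: image_image)
  qed (simp_all add: reflection_symmetry)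
  \<comment> \<open>Keeps the images of vertices inside \<open>V\<close> after a symmetry has been
    composed with a correcting group element.\<close>
  have G: "orthogonal_transformation g \<and> (\<forall>v\<in>V. g v \<in> V)" if "g \<in> G" for g
  proof -
    have "G \<subseteq> {g. orthogonal_transformation g \<and> (\<forall>v\<in>V. g v \<in> V)}"
      unfolding G_def using stable
      by (intro generated_group_least[OF inv])
        (auto simp: orthogonal_reflection_along orthogonal_transformation_compose
          orthogonal_transformation_id id_def)
    with that show ?thesis by auto
  qed
  have orthD: "f u \<bullet> f v = u \<bullet> v" if "orthogonal_transformation f" for f u v
    using that by (simp add: orthogonal_transformation_def)
  \<comment> \<open>An orthogonal map fixing x satisfies (f v - v) \<bullet> x = 0; taking a, b, c
    for x makes f v - v vanish.\<close>
  have fix_abc: "f = id" if "orthogonal_transformation f" "f a = a" "f b = b" "f c = c" for f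
  proof
    fix v
    have "(f v - v) \<bullet> x = 0" if "f x = x" for x
      using orthD[OF \<open>orthogonal_transformation f\<close>, of v x] that by (simp add: inner_diff_left)
    then have "f v - v = 0" using basis that by blast
    then show "f v = id v" by simp
  qed
  have cancel: "f \<in> G" if "w \<in> G" "w \<circ> f \<in> G" for f w
  proof -
    obtain w' where "w' \<in> G" "w' \<circ> w = id"
      using left_inverse_in_generated_group[OF inv] \<open>w \<in> G\<close> unfolding G_def by blast
    then have "w' \<circ> (w \<circ> f) = f" by (simp flip: comp_assoc)
    then show ?thesis using comp[OF \<open>w' \<in> G\<close> \<open>w \<circ> f \<in> G\<close>] by simp
  qed
  have id: "id \<in> G" by (simp only: G_def id_in_generated_group)
  have fix_ab: "f \<in> G"
    if f: "orthogonal_transformation f" "f c \<in> V" "f a = a" "f b = b" for f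
  proof (cases "f c = c")
    case True
    then show ?thesis using fix_abc[OF f(1,3,4)] id by simp
  next
    case False
    let ?s = "reflection_along (f c - c)"
    have fa: "f c \<bullet> a = c \<bullet> a" and fb: "f c \<bullet> b = c \<bullet> b" and fc: "f c \<bullet> f c = c \<bullet> c"
      using orthD[OF f(1), of c] f(3,4) by metis+
    have s: "?s \<in> G" using trans_c[OF f(2) False fa fb] .
    have "?s \<circ> f = id"
      using fa fb fc f by (intro fix_abc)
        (auto simp: orthogonal_transformation_compose orthogonal_reflection_along
          reflection_along_diff inner_diff_left intro!: reflection_along_orthogonal)
    then show ?thesis using cancel[OF s] id by simp
  qed
  have fix_a: "f \<in> G"
    if f: "orthogonal_transformation f" "\<And>v. v \<in> V \<Longrightarrow> f v \<in> V" "f a = a" for f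
  proof (cases "f b = b")
    case True
    then show ?thesis using fix_ab f abc by blast
  next
    case False
    let ?s = "reflection_along (f b - b)"
    have fa: "f b \<bullet> a = b \<bullet> a" and fb: "f b \<bullet> f b = b \<bullet> b"
      using orthD[OF f(1), of b] f(3) by metis+
    have s: "?s \<in> G" using trans_b[OF f(2)[OF abc(2)] False fa] .
    have "?s \<circ> f \<in> G"
      using fa fb f abc G[OF s] by (intro fix_ab)
        (auto simp: orthogonal_transformation_compose orthogonal_reflection_along
          reflection_along_diff inner_diff_left intro!: reflection_along_orthogonal)
    then show ?thesis using cancel[OF s] by simp
  qed
  show "symmetries (convex hull V) \<subseteq> G"
  proof
    fix f assume "f \<in> symmetries (convex hull V)"
    then have f: "orthogonal_transformation f" "\<And>v. v \<in> V \<Longrightarrow> f v \<in> V"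
      using symmetries_convex_hull_orthogonal 0 r by blast+
    obtain w where w: "w \<in> G" "w (f a) = a" using trans_a[OF f(2)[OF abc(1)]] by auto
    have "w \<circ> f \<in> G"
      using w f G[OF w(1)] by (intro fix_a) (auto simp: orthogonal_transformation_compose)
    then show "f \<in> G" using cancel[OF w(1)] by simp
  qed
qed

text \<open>The Gram matrix is required only up to the factor c, so that the vectors may have simple
  coordinates; the factor 1 / sqrt c in \<phi> restores length sqrt 2 and leaves the reflections
  alone.\<close>

lemma identifies_basis:
  fixes n1 n2 n3 :: "real^3"
  assumes "c > 0"
    and norms: "n1 \<bullet> n1 = 2 * c" "n2 \<bullet> n2 = 2 * c" "n3 \<bullet> n3 = 2 * c"
    and gram: "n1 \<bullet> n2 = c * x1" "n2 \<bullet> n3 = c * x2" "n1 \<bullet> n3 = c * x3"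
    and indep: "\<And>u v w. u *\<^sub>R n1 + v *\<^sub>R n2 + w *\<^sub>R n3 = 0 \<Longrightarrow> u = 0 \<and> v = 0 \<and> w = 0"
    and W: "generated_group (reflection_along n1, reflection_along n2, reflection_along n3) = W"
  shows "\<exists>\<phi>. identifies \<phi> (x1, x2, x3) W"
proof -
  define d where "d = 1 / sqrt c"
  have d: "d \<noteq> 0" "d * d * c = 1" using assms(1) by (simp_all add: d_def)
  define \<phi> :: vmap where "\<phi> = (\<lambda>v. d *\<^sub>R (v$1 *\<^sub>R n1 + v$2 *\<^sub>R n2 + v$3 *\<^sub>R n3))"
  have lin: "linear \<phi>"
    by (intro linearI) (simp_all add: \<phi>_def algebra_simps)
  have "v = 0" if "\<phi> v = 0" for v
  proof -
    have "v$1 *\<^sub>R n1 + v$2 *\<^sub>R n2 + v$3 *\<^sub>R n3 = 0" using that d(1) by (simp add: \<phi>_def)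
    from indep[OF this] show "v = 0" by (simp add: vec_eq_iff forall_3)
  qed
  then have "inj \<phi>" by (simp add: linear_injective_0[OF lin])
  then have bij: "bij \<phi>" using linear_injective_imp_surjective[OF lin] by (simp add: bij_def)
  have gram': "n2 \<bullet> n1 = c * x1" "n3 \<bullet> n2 = c * x2" "n3 \<bullet> n1 = c * x3"
    using gram by (simp_all only: inner_commute)
  have "\<phi> u \<bullet> \<phi> v = form (x1, x2, x3) u v" for u v
  proof -
    have "\<phi> u \<bullet> \<phi> v = d * d * c * form (x1, x2, x3) u v"
      by (simp add: \<phi>_def inner_add_left inner_add_right form_expand norms gram gram' algebra_simps)
    then show ?thesis by (simp add: d(2))
  qed
  then have iso: "isometry_to_euclidean (x1, x2, x3) \<phi>"
    using lin bij by (simp add: isometry_to_euclidean_def)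
  have "\<phi> (axis 1 1) = d *\<^sub>R n1" "\<phi> (axis 2 1) = d *\<^sub>R n2" "\<phi> (axis 3 1) = d *\<^sub>R n3"
    by (simp_all add: \<phi>_def axis_components)
  then have "generated_group (transport_system \<phi> (reflections (x1, x2, x3))) = W"
    using W d(1) by (simp add: transport_system_reflections[OF iso] reflection_along_scaleR)
  then show ?thesis using iso by (auto simp: identifies_iff)
qed

section \<open>Calculations with vectors in coordinates\<close>

lemma vector3_eq_iff:
  "(vector [a, b, c] :: real^3) = vector [a', b', c'] \<longleftrightarrow> a = a' \<and> b = b' \<and> c = c'"
  by (auto simp: vec_eq_iff forall_3)

lemma vector3_inner:
  "(vector [a, b, c] :: real^3) \<bullet> vector [a', b', c'] = a * a' + b * b' + c * c'"
  by (simp add: inner_vec_def sum_3)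

lemma vector3_arith:
  "(vector [a, b, c] :: real^3) + vector [a', b', c'] = vector [a + a', b + b', c + c']"
  "(vector [a, b, c] :: real^3) - vector [a', b', c'] = vector [a - a', b - b', c - c']"
  "d *\<^sub>R (vector [a, b, c] :: real^3) = vector [d * a, d * b, d * c]"
  "(0 :: real^3) = vector [0, 0, 0]"
  by (auto simp: vec_eq_iff forall_3)

text \<open>The coefficient k of the reflection is supplied by hand and checked by multiplication,
  which avoids dividing expressions in the golden ratio.\<close>

lemma reflection_along_vector3:
  assumes "n1 * n1 + n2 * n2 + n3 * n3 = N" "N \<noteq> 0" "2 * (n1 * v1 + n2 * v2 + n3 * v3) = k * N"
  shows "reflection_along (vector [n1, n2, n3]) (vector [v1, v2, v3])
    = vector [v1 - k * n1, v2 - k * n2, v3 - k * n3]"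
  using assms by (simp add: reflection_along_def vector3_inner vector3_arith)

text \<open>Reflecting m in the mirror of n conjugates one group element by another. The factor d
  adjusts the length, so that the result can be the exact difference of two vertices required
  later.\<close>

lemma mirror_image:
  fixes a b c :: "real^3"
  defines "G \<equiv> generated_group (reflection_along a, reflection_along b, reflection_along c)"
  assumes mirrors: "reflection_along (vector [n1, n2, n3]) \<in> G" "reflection_along (vector [m1, m2, m3]) \<in> G"
    and k: "n1 * n1 + n2 * n2 + n3 * n3 = N" "N \<noteq> 0" "2 * (n1 * m1 + n2 * m2 + n3 * m3) = k * N"
    and p: "d \<noteq> 0" "p1 = d * (m1 - k * n1)" "p2 = d * (m2 - k * n2)" "p3 = d * (m3 - k * n3)"
  shows "reflection_along (vector [p1, p2, p3]) \<in> G"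
proof -
  have "vector [p1, p2, p3] = d *\<^sub>R reflection_along (vector [n1, n2, n3]) (vector [m1, m2, m3])"
    using p by (simp add: reflection_along_vector3[OF k] vector3_arith)
  then show ?thesis
    using p(1) mirrors comp_in_generated_group[OF involutive_reflection_along]
    by (simp add: reflection_along_scaleR reflection_along_image G_def)
qed

lemma vector3_norm: "norm (vector [a, b, c] :: real^3) = sqrt (a * a + b * b + c * c)"
  by (simp add: norm_eq_sqrt_inner vector3_inner)

lemma vector3_cases: obtains a b c where "v = (vector [a, b, c] :: real^3)"
proof
  show "v = vector [v$1, v$2, v$3]" by (simp add: vec_eq_iff forall_3)
qed

section \<open>The tetrahedron\<close>

text \<open>The mirrors are those of the vectors with two entries \<plusminus>1 and one entry 0, the
  root system D3 = A3; half the difference of two vertices is such a root.\<close>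

lemma identifies_W_A3: "\<exists>\<phi>. identifies \<phi> (0, -1, -1) W_A3"
proof (rule identifies_basis[where c = 1])
  let ?n1 = "vector [1, 1, 0] :: real^3" and ?n2 = "vector [1, -1, 0] :: real^3"
    and ?n3 = "vector [-1, 0, 1] :: real^3"
  let ?V = "{vector [1, 1, 1], vector [1, - 1, - 1], vector [- 1, 1, - 1], vector [- 1, - 1, 1]} :: (real^3) set"
  let ?G = "generated_group (reflection_along ?n1, reflection_along ?n2, reflection_along ?n3)"
  note mirror = mirror_image[where a = ?n1 and b = ?n2 and c = ?n3]
  note gens = generated_group_gens[where ?S1.0 = "reflection_along ?n1" and ?S2.0 = "reflection_along ?n2"
        and ?S3.0 = "reflection_along ?n3"]
  have m1: "reflection_along (vector [0, 1, 1]) \<in> ?G"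
    by (rule mirror[OF gens(1) gens(3), where k = "-1" and d = 1 and N = 2]) simp_all
  have m2: "reflection_along (vector [1, 0, 1]) \<in> ?G"
    by (rule mirror[OF m1 gens(2), where k = "-1" and d = 1 and N = 2]) simp_all
  have m3: "reflection_along (vector [0, -1, 1]) \<in> ?G"
    by (rule mirror[OF gens(3) gens(2), where k = "-1" and d = 1 and N = 2]) simp_all
  have scaled: "reflection_along (vector [p1, p2, p3]) \<in> ?G"
    if "reflection_along (vector [n1, n2, n3]) \<in> ?G" "d \<noteq> 0" "p1 = d * n1" "p2 = d * n2" "p3 = d * n3"
    for p1 p2 p3 n1 n2 n3 d
    using that reflection_along_scaleR[of d "vector [n1, n2, n3]"] by (simp add: vector3_arith)
  \<comment> \<open>Exactly the differences that occur: three from the vertex a, two from b among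
    the vertices other than a, and one from c after a and b are settled.\<close>
  have roots: "reflection_along (vector [0, -2, -2]) \<in> ?G" "reflection_along (vector [-2, 0, -2]) \<in> ?G"
    "reflection_along (vector [-2, -2, 0]) \<in> ?G" "reflection_along (vector [-2, 2, 0]) \<in> ?G"
    "reflection_along (vector [-2, 0, 2]) \<in> ?G" "reflection_along (vector [0, -2, 2]) \<in> ?G"
    by (rule scaled[OF m1, of "-2"] scaled[OF m2, of "-2"] scaled[OF gens(1), of "-2"]
        scaled[OF gens(2), of "-2"] scaled[OF gens(3), of 2] scaled[OF m3, of 2]; simp)+
  show "?G = W_A3"
    unfolding tetrahedron_def
  proof (rule generated_group_eq_symmetries[where r = "sqrt 3" and a = "vector [1, 1, 1]"
        and b = "vector [1, -1, -1]" and c = "vector [-1, 1, -1]"])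
    have "(\<Sum>v\<in>?V. (1 / 4) *\<^sub>R v) = 0"
      by (simp add: vec_eq_iff forall_3)
    then show "0 \<in> convex hull ?V"
      using convex_sum[of ?V "convex hull ?V" "\<lambda>_. 1 / 4" "\<lambda>v. v"]
      by (simp add: vector3_eq_iff hull_inc)
    show "norm v = sqrt 3" if "v \<in> ?V" for v
      using that by (auto simp: vector3_norm)
    show "reflection_along k v \<in> ?V" if "k \<in> {?n1, ?n2, ?n3}" "v \<in> ?V" for k v
      using that by (auto simp: reflection_along_def vector3_inner vector3_arith vector3_eq_iff)
    show "v = 0" if "v \<bullet> vector [1, 1, 1] = 0" "v \<bullet> vector [1, -1, -1] = 0" "v \<bullet> vector [-1, 1, -1] = 0" for v :: "real^3"
      using that by (cases v rule: vector3_cases) (simp add: vector3_inner vector3_arith vector3_eq_iff)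
    show "\<exists>w\<in>?G. w u = vector [1, 1, 1]" if "u \<in> ?V" for u
    proof (cases "u = vector [1, 1, 1]")
      case True
      then show ?thesis by (intro bexI[OF _ id_in_generated_group]) simp
    next
      case False
      then have "reflection_along (u - vector [1, 1, 1]) \<in> ?G"
        using that roots by (auto simp: vector3_arith)
      moreover have "reflection_along (u - vector [1, 1, 1]) u = vector [1, 1, 1]"
        using that by (intro reflection_along_diff) (auto simp: vector3_inner)
      ultimately show ?thesis by blast
    qed
  qed (use roots in \<open>auto simp: vector3_arith vector3_inner\<close>)
qed (simp_all add: vector3_inner vector3_arith vector3_eq_iff)

section \<open>The octahedron\<close>

lemma octahedron_vertices:
  "{axis i s | i s. s \<in> {1, - 1}} = {vector [1, 0, 0], vector [-1, 0, 0], vector [0, 1, 0],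
     vector [0, -1, 0], vector [0, 0, 1], vector [0, 0, -1] :: real^3}"
proof -
  have "axis 1 s = (vector [s, 0, 0] :: real^3)" "axis 2 s = (vector [0, s, 0] :: real^3)"
    "axis 3 s = (vector [0, 0, s] :: real^3)" for s
    by (simp_all add: vec_eq_iff forall_3 axis_def)
  moreover have "{axis i s | i s. s \<in> {1, - 1}} = (\<Union>i\<in>UNIV. {axis i 1, axis i (-1) :: real^3})"
    by auto
  ultimately show ?thesis by (simp only: UNIV_3 UN_insert UN_empty) auto
qed

text \<open>Signed permutations: \<open>?n2\<close> and \<open>?n3\<close> swap adjacent coordinates
  and \<open>?n1\<close> changes a sign. All three vectors must have equal length, which explains
  the entry sqrt 2.\<close>

lemma identifies_W_B3: "\<exists>\<phi>. identifies \<phi> (0, -1, - sqrt 2) W_B3"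
proof (rule identifies_basis[where c = 1])
  let ?n1 = "vector [sqrt 2, 0, 0] :: real^3" and ?n2 = "vector [0, -1, 1] :: real^3"
    and ?n3 = "vector [-1, 1, 0] :: real^3"
  let ?V = "{vector [1, 0, 0], vector [-1, 0, 0], vector [0, 1, 0],
     vector [0, -1, 0], vector [0, 0, 1], vector [0, 0, -1]} :: (real^3) set"
  let ?G = "generated_group (reflection_along ?n1, reflection_along ?n2, reflection_along ?n3)"
  note mirror = mirror_image[where a = ?n1 and b = ?n2 and c = ?n3]
  note gens = generated_group_gens[where ?S1.0 = "reflection_along ?n1" and ?S2.0 = "reflection_along ?n2"
        and ?S3.0 = "reflection_along ?n3"]
  have n1: "reflection_along ?n1 = reflection_along (vector [c, 0, 0])" if "c \<noteq> 0" for c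
    using reflection_along_scaleR[of "sqrt 2 / c" "vector [c, 0, 0]"] that by (simp add: vector3_arith)
  have e1: "reflection_along (vector [1, 0, 0]) \<in> ?G" "reflection_along (vector [-2, 0, 0]) \<in> ?G"
    using gens(1) n1[of 1] n1[of "-2"] by simp_all
  have e2: "reflection_along (vector [0, -2, 0]) \<in> ?G"
    by (rule mirror[OF gens(3) e1(1), where k = "-1" and d = "-2" and N = 2]) simp_all
  have e3: "reflection_along (vector [0, 0, -2]) \<in> ?G"
    by (rule mirror[OF gens(2) e2, where k = 2 and d = 1 and N = 2]) simp_all
  have m1: "reflection_along (vector [-1, -1, 0]) \<in> ?G"
    by (rule mirror[OF e1(1) gens(3), where k = "-2" and d = "-1" and N = 1]) simp_all
  have m2: "reflection_along (vector [0, -1, -1]) \<in> ?G"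
    by (rule mirror[OF e2 gens(2), where k = 1 and d = "-1" and N = 4]) simp_all
  have m3: "reflection_along (vector [-1, 0, 1]) \<in> ?G"
    by (rule mirror[OF gens(2) gens(3), where k = "-1" and d = 1 and N = 2]) simp_all
  have m4: "reflection_along (vector [-1, 0, -1]) \<in> ?G"
    by (rule mirror[OF e1(1) m3, where k = "-2" and d = "-1" and N = 1]) simp_all
  note roots = e1 e2 e3 m1 m2 m3 m4 gens
  show "?G = W_B3"
    unfolding octahedron_def octahedron_vertices
  proof (rule generated_group_eq_symmetries[where r = 1 and a = "vector [1, 0, 0]"
        and b = "vector [0, 1, 0]" and c = "vector [0, 0, 1]"])
    have "(1 / 2) *\<^sub>R vector [1, 0, 0] + (1 / 2) *\<^sub>R vector [-1, 0, 0] \<in> convex hull ?V"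
      by (intro convexD) (simp_all add: hull_inc)
    then show "0 \<in> convex hull ?V" by (simp add: vector3_arith)
    show "norm v = 1" if "v \<in> ?V" for v
      using that by (auto simp: vector3_norm)
    show "reflection_along k v \<in> ?V" if "k \<in> {?n1, ?n2, ?n3}" "v \<in> ?V" for k v
      using that by (auto simp: reflection_along_def vector3_inner vector3_arith vector3_eq_iff)
    show "v = 0" if "v \<bullet> vector [1, 0, 0] = 0" "v \<bullet> vector [0, 1, 0] = 0" "v \<bullet> vector [0, 0, 1] = 0" for v :: "real^3"
      using that by (cases v rule: vector3_cases) (simp add: vector3_inner vector3_arith vector3_eq_iff)
    show "\<exists>w\<in>?G. w u = vector [1, 0, 0]" if "u \<in> ?V" for u
    proof (cases "u = vector [1, 0, 0]")
      case True
      then show ?thesis by (intro bexI[OF _ id_in_generated_group]) simp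
    next
      case False
      then have "reflection_along (u - vector [1, 0, 0]) \<in> ?G"
        using that roots by (auto simp: vector3_arith)
      moreover have "reflection_along (u - vector [1, 0, 0]) u = vector [1, 0, 0]"
        using that by (intro reflection_along_diff) (auto simp: vector3_inner)
      ultimately show ?thesis by blast
    qed
  qed (use roots in \<open>auto simp: vector3_arith vector3_inner\<close>)
qed (simp_all add: vector3_inner vector3_arith vector3_eq_iff)

section \<open>The icosahedron\<close>

text \<open>The golden ratio is kept as a variable \<open>t\<close> with \<open>t * t = t + 1\<close>, so that the simplifier
  can reduce every coordinate to a linear expression in \<open>t\<close>.\<close>

definition icosahedron_vertices :: "real \<Rightarrow> (real^3) set" where
  "icosahedron_vertices t =
     {vector [0, 1, t], vector [0, 1, -t], vector [0, -1, t], vector [0, -1, -t],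
      vector [1, t, 0], vector [1, -t, 0], vector [-1, t, 0], vector [-1, -t, 0],
      vector [t, 0, 1], vector [t, 0, -1], vector [-t, 0, 1], vector [-t, 0, -1]}"

lemma icosahedron_eq:
  "icosahedron = convex hull icosahedron_vertices ((1 + sqrt 5) / 2)"
  unfolding icosahedron_def icosahedron_vertices_def Let_def
  by (rule arg_cong[where f = "\<lambda>V. convex hull V"]) auto

lemma icosahedron_vertices_coordinate_reflection:
  assumes "e \<in> {vector [2, 0, 0], vector [0, 2, 0], vector [0, 0, 2]}" "v \<in> icosahedron_vertices t"
  shows "reflection_along e v \<in> icosahedron_vertices t"
  using assms
  by (auto simp: icosahedron_vertices_def reflection_along_def vector3_inner vector3_arith vector3_eq_iff)

text \<open>The vector is the edge from (0, 1, t) to (-t, 0, 1). Like the edges 2 e_i it has squared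
  length 4, the value of \<open>N\<close> in most mirror computations below.\<close>

lemma icosahedron_vertices_reflection:
  assumes t: "t * t = t + 1" and v: "v \<in> icosahedron_vertices t"
  shows "reflection_along (vector [-t, -1, 1 - t]) v \<in> icosahedron_vertices t"
proof -
  have refl: "reflection_along (vector [-t, -1, 1 - t]) (vector [x, y, z]) =
      vector [x + k * t, y + k, z + k * (t - 1)]"
    if "2 * k = - (t * x + y + (t - 1) * z)" for x y z k
  proof -
    have "(- t) * (- t) + (- 1) * (- 1) + (1 - t) * (1 - t) = 4"
      using t by (simp add: algebra_simps)
    moreover have "2 * ((- t) * x + (- 1) * y + (1 - t) * z) = k * 4"
      using that by (simp add: algebra_simps)
    ultimately show ?thesis
      by (subst reflection_along_vector3) (auto simp: vector3_eq_iff algebra_simps)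
  qed
  let ?r = "reflection_along (vector [-t, -1, 1 - t])"
  \<comment> \<open>The vertices are grouped by k, half their inner product with the mirror's
    vector: four lie on the mirror, the other eight are swapped in pairs with opposite k.\<close>
  have "?r (vector [0, 1, -t]) = vector [0, 1, -t]" "?r (vector [0, -1, t]) = vector [0, -1, t]"
    "?r (vector [1, -t, 0]) = vector [1, -t, 0]" "?r (vector [-1, t, 0]) = vector [-1, t, 0]"
    by (simp_all add: refl[where k = 0] vector3_eq_iff algebra_simps t)
  moreover have "?r (vector [0, 1, t]) = vector [-t, 0, 1]" "?r (vector [t, 0, -1]) = vector [0, -1, -t]"
    by (simp_all add: refl[where k = "-1"] vector3_eq_iff algebra_simps t)
  moreover have "?r (vector [-t, 0, 1]) = vector [0, 1, t]" "?r (vector [0, -1, -t]) = vector [t, 0, -1]"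
    by (simp_all add: refl[where k = 1] vector3_eq_iff algebra_simps t)
  moreover have "?r (vector [1, t, 0]) = vector [-t, 0, -1]" "?r (vector [t, 0, 1]) = vector [-1, -t, 0]"
    by (simp_all add: refl[where k = "-t"] vector3_eq_iff algebra_simps t)
  moreover have "?r (vector [-1, -t, 0]) = vector [t, 0, 1]" "?r (vector [-t, 0, -1]) = vector [1, t, 0]"
    by (simp_all add: refl[where k = t] vector3_eq_iff algebra_simps t)
  ultimately show ?thesis
    using v unfolding icosahedron_vertices_def by auto
qed

lemma orbit_step:
  fixes l m n :: "real^3"
  defines "G \<equiv> generated_group (reflection_along l, reflection_along m, reflection_along n)"
  assumes "reflection_along k \<in> G" "reflection_along k u = u'" "\<exists>w\<in>G. w u' = a"
  shows "\<exists>w\<in>G. w u = a"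
proof -
  obtain w where "w \<in> G" "w u' = a" using assms(4) by blast
  then show ?thesis
    using comp_in_generated_group[OF involutive_reflection_along] assms(2,3)
    unfolding G_def by (intro bexI[of _ "w \<circ> reflection_along k"]) auto
qed

text \<open>Common to the three systems: each uses three of the vectors \<open>e1\<close>,
  \<open>e2\<close>, \<open>e3\<close>, \<open>r\<close>, and only the membership of the fourth
  reflection depends on the case.\<close>

lemma generated_group_eq_W_H3:
  fixes t :: real
  defines "t \<equiv> (1 + sqrt 5) / 2"
  defines "e1 \<equiv> vector [2, 0, 0]" and "e2 \<equiv> vector [0, 2, 0]" and "e3 \<equiv> vector [0, 0, 2]"
    and "r \<equiv> vector [-t, -1, 1 - t] :: real^3"
  defines "G \<equiv> \<lambda>n1 n2 n3. generated_group (reflection_along n1, reflection_along n2, reflection_along n3)"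
  assumes gens: "{n1, n2, n3} \<subseteq> {e1, e2, e3, r}"
    and mirrors: "reflection_along e1 \<in> G n1 n2 n3" "reflection_along e2 \<in> G n1 n2 n3"
      "reflection_along e3 \<in> G n1 n2 n3" "reflection_along r \<in> G n1 n2 n3"
  shows "G n1 n2 n3 = W_H3"
proof -
  have t: "t * t = t + 1" "t > 1"
    by (simp_all add: t_def field_simps)
  let ?G = "generated_group (reflection_along n1, reflection_along n2, reflection_along n3)"
  note mirror = mirror_image[where a = n1 and b = n2 and c = n3]
  note e = mirrors(1-3)[unfolded G_def e1_def e2_def e3_def]
  note r = mirrors(4)[unfolded G_def r_def]
  \<comment> \<open>\<open>e1\<close> reflected in itself is its negative; the scale t makes it the
    difference of (-t, 0, 1) and (t, 0, 1).\<close>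
  have e1': "reflection_along (vector [- 2 * t, 0, 0]) \<in> ?G"
    by (rule mirror[OF e(1) e(1), where k = 2 and d = t and N = 4]) (use t in simp_all)
  have r2: "reflection_along (vector [t, -1, 1 - t]) \<in> ?G"
    by (rule mirror[OF e(1) r, where k = "-t" and d = 1 and N = 4]) simp_all
  have r3: "reflection_along (vector [-t, 1, 1 - t]) \<in> ?G"
    by (rule mirror[OF e(2) r, where k = "-1" and d = 1 and N = 4]) simp_all
  have r4: "reflection_along (vector [t, 1, 1 - t]) \<in> ?G"
    by (rule mirror[OF e(2) r2, where k = "-1" and d = 1 and N = 4]) simp_all
  have q: "reflection_along (vector [1 - t, -t, -1]) \<in> ?G"
    by (rule mirror[OF r e(1), where k = "-t" and d = 1 and N = 4]) (simp_all add: algebra_simps t)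
  have q2: "reflection_along (vector [-1, t + 1, -t]) \<in> ?G"
    by (rule mirror[OF e(2) q, where k = "-t" and d = t and N = 4]) (use t in \<open>simp_all add: algebra_simps\<close>)
  have q3: "reflection_along (vector [1, t + 1, -t]) \<in> ?G"
    by (rule mirror[OF e(1) q2, where k = "-1" and d = 1 and N = 4]) simp_all
  have p: "reflection_along (vector [-1, 1 - t, t]) \<in> ?G"
    by (rule mirror[OF r e(3), where k = "1 - t" and d = 1 and N = 4]) (simp_all add: algebra_simps t)
  let ?V = "icosahedron_vertices t"
  let ?a = "vector [0, 1, t] :: real^3"
  note step = orbit_step[where l = n1 and m = n2 and n = n3]
  note flip = reflection_along_def vector3_inner vector3_arith vector3_eq_iff
  \<comment> \<open>Coordinate reflections act transitively on each of the three cyclic families of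
    four vertices; the mirrors \<open>p\<close> and \<open>r2\<close> link the other two families to
    that of \<open>?a\<close>.\<close>
  have a: "\<exists>w\<in>?G. w ?a = ?a" by (intro bexI[OF _ id_in_generated_group]) simp
  have a2: "\<exists>w\<in>?G. w (vector [0, -1, t]) = ?a"
    by (rule step[OF e(2) _ a]) (simp add: flip)
  have a3: "\<exists>w\<in>?G. w (vector [0, 1, -t]) = ?a"
    by (rule step[OF e(3) _ a]) (simp add: flip)
  have a4: "\<exists>w\<in>?G. w (vector [0, -1, -t]) = ?a"
    by (rule step[OF e(3) _ a2]) (simp add: flip)
  have b: "\<exists>w\<in>?G. w (vector [1, t, 0]) = ?a"
    by (rule step[OF p _ a], subst reflection_along_vector3[where k = "-1" and N = 4])
      (simp_all add: vector3_eq_iff algebra_simps t)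
  have b2: "\<exists>w\<in>?G. w (vector [-1, t, 0]) = ?a"
    by (rule step[OF e(1) _ b]) (simp add: flip)
  have b3: "\<exists>w\<in>?G. w (vector [1, -t, 0]) = ?a"
    by (rule step[OF e(2) _ b]) (simp add: flip)
  have b4: "\<exists>w\<in>?G. w (vector [-1, -t, 0]) = ?a"
    by (rule step[OF e(2) _ b2]) (simp add: flip)
  have c: "\<exists>w\<in>?G. w (vector [t, 0, 1]) = ?a"
    by (rule step[OF r2 _ a], subst reflection_along_vector3[where k = 1 and N = 4])
      (simp_all add: vector3_eq_iff algebra_simps t)
  have c2: "\<exists>w\<in>?G. w (vector [-t, 0, 1]) = ?a"
    by (rule step[OF e(1) _ c]) (simp add: flip)
  have c3: "\<exists>w\<in>?G. w (vector [t, 0, -1]) = ?a"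
    by (rule step[OF e(3) _ c]) (simp add: flip)
  have c4: "\<exists>w\<in>?G. w (vector [-t, 0, -1]) = ?a"
    by (rule step[OF e(3) _ c2]) (simp add: flip)
  have "?G = symmetries (convex hull ?V)"
  proof (rule generated_group_eq_symmetries[where r = "sqrt (t + 2)" and a = ?a
        and b = "vector [0, -1, t]" and c = "vector [t, 0, 1]"])
    have "(1 / 2) *\<^sub>R ?a + (1 / 2) *\<^sub>R vector [0, -1, -t] \<in> convex hull ?V"
      by (intro convexD) (simp_all add: hull_inc icosahedron_vertices_def)
    then show "0 \<in> convex hull ?V" by (simp add: vector3_arith)
    show "norm v = sqrt (t + 2)" if "v \<in> ?V" for v
      using that t(1) by (auto simp: vector3_norm icosahedron_vertices_def)
    show "reflection_along k v \<in> ?V" if "k \<in> {n1, n2, n3}" "v \<in> ?V" for k v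
    proof -
      have "k \<in> {e1, e2, e3} \<or> k = r" using that(1) gens by blast
      then show ?thesis
        using icosahedron_vertices_coordinate_reflection[OF _ that(2)]
          icosahedron_vertices_reflection[OF t(1) that(2)]
        unfolding e1_def e2_def e3_def r_def by blast
    qed
    show "v = 0" if "v \<bullet> ?a = 0" "v \<bullet> vector [0, -1, t] = 0" "v \<bullet> vector [t, 0, 1] = 0" for v
    proof (cases v rule: vector3_cases)
      case (1 x y z)
      then have "y + z * t = 0" "z * t = y" "x * t + z = 0" using that by (simp_all add: vector3_inner)
      then have "y = 0" "z * t = 0" "x * t + z = 0" by simp_all
      then show ?thesis using t(2) 1 by (auto simp: vector3_arith)
    qed
    show "\<exists>w\<in>?G. w u = ?a" if "u \<in> ?V" for u
      using that a a2 a3 a4 b b2 b3 b4 c c2 c3 c4 unfolding icosahedron_vertices_def by blast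
    \<comment> \<open>The inner product with \<open>?a\<close> is t exactly for the five neighbours
      of \<open>?a\<close>, so four differences occur. Of these neighbours only (t, 0, 1) and (-t,
      0, 1) also have inner product t with (0, -1, t).\<close>
    show "reflection_along (u - vector [0, -1, t]) \<in> ?G"
      if "u \<in> ?V" "u \<noteq> vector [0, -1, t]" "u \<bullet> ?a = vector [0, -1, t] \<bullet> ?a" for u
      using that t r3 r4 q2 q3
      by (auto simp: icosahedron_vertices_def vector3_inner vector3_arith)
    show "reflection_along (u - vector [t, 0, 1]) \<in> ?G"
      if "u \<in> ?V" "u \<noteq> vector [t, 0, 1]" "u \<bullet> ?a = vector [t, 0, 1] \<bullet> ?a"
        "u \<bullet> vector [0, -1, t] = vector [t, 0, 1] \<bullet> (vector [0, -1, t] :: real^3)" for u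
      using that t e1'
      by (auto simp: icosahedron_vertices_def vector3_inner vector3_arith)
  qed (simp_all add: icosahedron_vertices_def)
  then show ?thesis by (simp add: G_def icosahedron_eq t_def)
qed

text \<open>The inner products of \<open>?r\<close> with \<open>?e1\<close>, \<open>?e2\<close>,
  \<open>?e3\<close> are 2 times -t, -1 and 1 - t, that is, 2 times -2 cos of pi/5, pi/3 and 2 pi/5.
  Choosing two orthogonal coordinate vectors thus gives the three triples; the remaining work is to
  find the third coordinate mirror.\<close>

lemma identifies_W_H3:
  fixes t :: real
  defines "t \<equiv> (1 + sqrt 5) / 2"
  shows "\<exists>\<phi>. identifies \<phi> (0, -1, -t) W_H3"
    and "\<exists>\<phi>. identifies \<phi> (0, -1, 1 - t) W_H3"
    and "\<exists>\<phi>. identifies \<phi> (0, -t, 1 - t) W_H3"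
proof -
  have t: "t * t = t + 1" "t > 1"
    by (simp_all add: t_def field_simps)
  let ?e1 = "vector [2, 0, 0] :: real^3" and ?e2 = "vector [0, 2, 0] :: real^3"
    and ?e3 = "vector [0, 0, 2] :: real^3" and ?r = "vector [-t, -1, 1 - t] :: real^3"
  let ?G = "\<lambda>n1 n2 n3. generated_group (reflection_along n1, reflection_along n2, reflection_along n3)"
  note gram = vector3_inner vector3_arith vector3_eq_iff
  show "\<exists>\<phi>. identifies \<phi> (0, -1, -t) W_H3"
  proof (rule identifies_basis[where c = 2])
    note mirror = mirror_image[where a = ?e1 and b = ?e2 and c = ?r]
    note gens = generated_group_gens[where ?S1.0 = "reflection_along ?e1" and ?S2.0 = "reflection_along ?e2"
        and ?S3.0 = "reflection_along ?r"]
    have r2: "reflection_along (vector [t, -1, 1 - t]) \<in> ?G ?e1 ?e2 ?r"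
      by (rule mirror[OF gens(1) gens(3), where k = "-t" and d = 1 and N = 4]) simp_all
    have r3: "reflection_along (vector [t, 1, 1 - t]) \<in> ?G ?e1 ?e2 ?r"
      by (rule mirror[OF gens(2) r2, where k = "-1" and d = 1 and N = 4]) simp_all
    have q: "reflection_along (vector [1 - t, -t, -1]) \<in> ?G ?e1 ?e2 ?r"
      by (rule mirror[OF gens(3) gens(1), where k = "-t" and d = 1 and N = 4]) (simp_all add: algebra_simps t)
    have p: "reflection_along (vector [1, 1 - t, -t]) \<in> ?G ?e1 ?e2 ?r"
      by (rule mirror[OF q r3, where k = "-1" and d = 1 and N = 4]) (simp_all add: algebra_simps t)
    have p2: "reflection_along (vector [-1, 1 - t, t]) \<in> ?G ?e1 ?e2 ?r"
      by (rule mirror[OF gens(2) p, where k = "1 - t" and d = "-1" and N = 4]) simp_all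
    \<comment> \<open>The reflection in \<open>?r\<close> takes (-1, 1 - t, t) to that vector minus
      (t - 1) \<open>?r\<close>, which is \<open>?e3\<close> by the equation of t.\<close>
    have "reflection_along ?e3 \<in> ?G ?e1 ?e2 ?r"
      by (rule mirror[OF gens(3) p2, where k = "t - 1" and d = 1 and N = 4]) (simp_all add: algebra_simps t)
    then show "?G ?e1 ?e2 ?r = W_H3"
      using gens unfolding t_def by (intro generated_group_eq_W_H3) simp_all
  qed (use t in \<open>simp_all add: gram algebra_simps\<close>)
  show "\<exists>\<phi>. identifies \<phi> (0, -1, 1 - t) W_H3"
  proof (rule identifies_basis[where c = 2])
    note mirror = mirror_image[where a = ?e3 and b = ?e2 and c = ?r]
    note gens = generated_group_gens[where ?S1.0 = "reflection_along ?e3" and ?S2.0 = "reflection_along ?e2"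
        and ?S3.0 = "reflection_along ?r"]
    have p: "reflection_along (vector [-1, 1 - t, t]) \<in> ?G ?e3 ?e2 ?r"
      by (rule mirror[OF gens(3) gens(1), where k = "1 - t" and d = 1 and N = 4]) (simp_all add: algebra_simps t)
    have p2: "reflection_along (vector [1, t - 1, t]) \<in> ?G ?e3 ?e2 ?r"
      by (rule mirror[OF gens(1) p, where k = t and d = "-1" and N = 4]) simp_all
    have p3: "reflection_along (vector [-1, t - 1, -t]) \<in> ?G ?e3 ?e2 ?r"
      by (rule mirror[OF gens(1) _, where k = t and d = 1 and N = 4],
          rule mirror[OF gens(2) p, where k = "1 - t" and d = 1 and N = 4]) simp_all
    have q: "reflection_along (vector [t - 1, t, 1]) \<in> ?G ?e3 ?e2 ?r"
      by (rule mirror[OF p2 p3, where k = "-t" and d = 1 and N = 4]) (simp_all add: algebra_simps t)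
    \<comment> \<open>Here (t - 1, t, 1) + t \<open>?r\<close> is minus \<open>?e1\<close>.\<close>
    have "reflection_along ?e1 \<in> ?G ?e3 ?e2 ?r"
      by (rule mirror[OF gens(3) q, where k = "-t" and d = "-1" and N = 4]) (simp_all add: algebra_simps t)
    then show "?G ?e3 ?e2 ?r = W_H3"
      using gens unfolding t_def by (intro generated_group_eq_W_H3) simp_all
  qed (use t in \<open>simp_all add: gram algebra_simps\<close>)
  show "\<exists>\<phi>. identifies \<phi> (0, -t, 1 - t) W_H3"
  proof (rule identifies_basis[where c = 2])
    note mirror = mirror_image[where a = ?e3 and b = ?e1 and c = ?r]
    note gens = generated_group_gens[where ?S1.0 = "reflection_along ?e3" and ?S2.0 = "reflection_along ?e1"
        and ?S3.0 = "reflection_along ?r"]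
    have r2: "reflection_along (vector [t, -1, 1 - t]) \<in> ?G ?e3 ?e1 ?r"
      by (rule mirror[OF gens(2) gens(3), where k = "-t" and d = 1 and N = 4]) simp_all
    have r3: "reflection_along (vector [t, -1, t - 1]) \<in> ?G ?e3 ?e1 ?r"
      by (rule mirror[OF gens(1) r2, where k = "1 - t" and d = 1 and N = 4]) simp_all
    \<comment> \<open>Changing the signs of the first and third entries of \<open>?r\<close> and
      adding \<open>?r\<close> leaves only the second coordinate.\<close>
    have "reflection_along ?e2 \<in> ?G ?e3 ?e1 ?r"
      by (rule mirror[OF gens(3) r3, where k = "-1" and d = "-1" and N = 4]) (simp_all add: algebra_simps t)
    then show "?G ?e3 ?e1 ?r = W_H3"
      using gens unfolding t_def by (intro generated_group_eq_W_H3) simp_all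
  qed (use t in \<open>simp_all add: gram algebra_simps\<close>)
qed

section \<open>The angles\<close>

text \<open>At \<theta> = pi/5 the angles 3 \<theta> and 2 \<theta> add up to pi, so cos (3
  \<theta>) = - cos (2 \<theta>). The resulting cubic in c has the root -1, and a quadratic
  remains.\<close>

lemma cos_pi_fifths:
  "2 * cos (pi / 5) = (1 + sqrt 5) / 2" "2 * cos (2 * pi / 5) = (1 + sqrt 5) / 2 - 1"
proof -
  define c where "c = cos (pi / 5)"
  have pos: "c > 0" unfolding c_def by (rule cos_gt_zero) (simp_all add: field_simps)
  have double: "cos (2 * pi / 5) = 2 * c\<^sup>2 - 1"
    using cos_double_cos[of "pi / 5"] by (simp add: c_def)
  have "4 * c ^ 3 - 3 * c = cos (3 * (pi / 5))"
    by (simp only: cos_treble_cos c_def)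
  also have "\<dots> = cos (pi - 2 * pi / 5)"
    by (rule arg_cong[where f = cos]) (simp add: field_simps)
  also have "\<dots> = - (2 * c\<^sup>2 - 1)" by (simp only: cos_pi_minus double)
  finally have "4 * c ^ 3 - 3 * c = - (2 * c\<^sup>2 - 1)" .
  then have "(c + 1) * (4 * c\<^sup>2 - 2 * c - 1) = 0"
    by (simp add: algebra_simps power2_eq_square power3_eq_cube)
  with pos have quadratic: "4 * c\<^sup>2 = 2 * c + 1" by simp
  then have "(4 * c - 1)\<^sup>2 = 5"
    by (simp add: power2_eq_square algebra_simps)
  \<comment> \<open>Selects the root of the quadratic with the positive sign of sqrt 5.\<close>
  moreover have "4 * c - 1 \<ge> 0"
  proof (rule ccontr)
    assume "\<not> ?thesis"
    then have "4 * c < 1" by simp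
    then have "4 * c\<^sup>2 \<le> c" using pos by (simp add: power2_eq_square)
    then show False using quadratic pos by simp
  qed
  ultimately have "sqrt 5 = 4 * c - 1" by (metis real_sqrt_unique)
  then show "2 * cos (pi / 5) = (1 + sqrt 5) / 2" "2 * cos (2 * pi / 5) = (1 + sqrt 5) / 2 - 1"
    using quadratic by (simp_all add: double flip: c_def)
qed

lemma cos_triple_values:
  "cos_triple (pi/2) (pi/3) (pi/3) = (0, -1, -1)"
  "cos_triple (pi/2) (pi/3) (pi/4) = (0, -1, - sqrt 2)"
  "cos_triple (pi/2) (pi/3) (pi/5) = (0, -1, - ((1 + sqrt 5) / 2))"
  "cos_triple (pi/2) (pi/3) (2*pi/5) = (0, -1, 1 - (1 + sqrt 5) / 2)"
  "cos_triple (pi/2) (pi/5) (2*pi/5) = (0, - ((1 + sqrt 5) / 2), 1 - (1 + sqrt 5) / 2)"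
  using cos_pi_fifths by (simp_all add: cos_triple_def cos_60 cos_45 field_simps)

section \<open>Comparing the three icosahedral orbits\<close>

lemma identifies_H3_triples: "t \<in> set H3_triples \<Longrightarrow> \<exists>\<phi>. identifies \<phi> t W_H3"
  using identifies_W_H3 by (auto simp: H3_triples_def cos_triple_values)

text \<open>In terms of the golden ratio t the three values are t + 2, 3 - t and 3, which differ
  because t > 1.\<close>

lemma inj_on_triple_invariant_H3_triples: "inj_on triple_invariant (set H3_triples)"
  and distinct_H3_triples: "distinct H3_triples"
proof -
  define t where "t = (1 + sqrt 5) / 2"
  have t: "t * t = t + 1" "t > 1"
    by (simp_all add: t_def field_simps)
  have H3: "H3_triples = [(0, -1, -t), (0, -1, 1 - t), (0, -t, 1 - t)]"
    by (simp add: H3_triples_def cos_triple_values t_def)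
  show "inj_on triple_invariant (set H3_triples)"
    using t by (auto simp: H3 triple_invariant_def power2_eq_square algebra_simps)
  show "distinct H3_triples" using t by (auto simp: H3)
qed

lemma triple_orbit_self: "x \<in> triple_orbit x"
  by (simp add: triple_orbit_def)

lemma triple_orbit_trans_sym:
  "x \<in> triple_orbit t \<Longrightarrow> y \<in> triple_orbit t \<Longrightarrow> y \<in> triple_orbit x"
  unfolding triple_orbit_def mem_Collect_eq by (blast intro: equivclp_sym equivclp_trans)

theorem theorem1p7:
  shows
   "(\<forall>x \<in> triple_orbit (cos_triple (pi/2) (pi/3) (pi/3)). \<exists>\<phi>. identifies \<phi> x W_A3) \<and>
    (\<forall>x \<in> triple_orbit (cos_triple (pi/2) (pi/3) (pi/4)). \<exists>\<phi>. identifies \<phi> x W_B3) \<and>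
    (\<forall>t \<in> set H3_triples. \<forall>x \<in> triple_orbit t. \<exists>\<phi>. identifies \<phi> x W_H3) \<and>
    distinct (map triple_orbit H3_triples) \<and>
    (\<forall>t \<in> set H3_triples. \<forall>x \<in> triple_orbit t. \<forall>\<phi>. identifies \<phi> x W_H3 \<longrightarrow>
       generating_reflections W_H3 (transport_system \<phi> (reflections x))) \<and>
    (\<forall>t \<in> set H3_triples. \<forall>t' \<in> set H3_triples.
       \<forall>x \<in> triple_orbit t. \<forall>x' \<in> triple_orbit t'. \<forall>\<phi> \<phi>'.
         identifies \<phi> x W_H3 \<longrightarrow> identifies \<phi>' x' W_H3 \<longrightarrow>
         (same_choice (transport_system \<phi> (reflections x)) (transport_system \<phi>' (reflections x'))
            \<longleftrightarrow> t = t'))"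
proof (intro conjI ballI allI impI)
  show "\<exists>\<phi>. identifies \<phi> x W_A3" if "x \<in> triple_orbit (cos_triple (pi/2) (pi/3) (pi/3))" for x
    using identifies_triple_orbit[OF that] identifies_W_A3 by (auto simp: cos_triple_values)
  show "\<exists>\<phi>. identifies \<phi> x W_B3" if "x \<in> triple_orbit (cos_triple (pi/2) (pi/3) (pi/4))" for x
    using identifies_triple_orbit[OF that] identifies_W_B3 by (auto simp: cos_triple_values)
  show "\<exists>\<phi>. identifies \<phi> x W_H3" if "t \<in> set H3_triples" "x \<in> triple_orbit t" for t x
    using identifies_triple_orbit[OF that(2)] identifies_H3_triples[OF that(1)] by blast
  \<comment> \<open>Equal orbits would share their base points, on which the invariant takes
    different values.\<close>
  have "inj_on triple_orbit (set H3_triples)"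
    using inj_on_triple_invariant_H3_triples triple_orbit_self triple_orbit_invariant
    by (metis inj_on_def)
  then show "distinct (map triple_orbit H3_triples)"
    using distinct_H3_triples by (simp add: distinct_map)
  show "generating_reflections W_H3 (transport_system \<phi> (reflections x))"
    if "identifies \<phi> x W_H3" for x \<phi>
  proof -
    have iso: "isometry_to_euclidean x \<phi>"
      and "generated_group (transport_system \<phi> (reflections x)) = W_H3"
      using that by (auto simp: identifies_iff)
    then show ?thesis
      using isometry_axis_nonzero[OF iso]
      by (auto simp: generating_reflections_def transport_system_reflections[OF iso])
  qed
  show "same_choice (transport_system \<phi> (reflections x)) (transport_system \<phi>' (reflections x')) \<longleftrightarrow> t = t'"
    if H3: "t \<in> set H3_triples" "t' \<in> set H3_triples"
      and x: "x \<in> triple_orbit t" "x' \<in> triple_orbit t'"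
      and "identifies \<phi> x W_H3" "identifies \<phi>' x' W_H3" for t t' x x' \<phi> \<phi>'
  proof
    have iso: "isometry_to_euclidean x \<phi>" "isometry_to_euclidean x' \<phi>'"
      using that by (auto simp: identifies_iff)
    show "t = t'"
      if "same_choice (transport_system \<phi> (reflections x)) (transport_system \<phi>' (reflections x'))"
      using same_choice_imp_invariant_eq[OF iso that] x[THEN triple_orbit_invariant]
        inj_onD[OF inj_on_triple_invariant_H3_triples _ H3] by simp
    show "same_choice (transport_system \<phi> (reflections x)) (transport_system \<phi>' (reflections x'))"
      if "t = t'"
      using triple_orbit_imp_same_choice[OF iso] triple_orbit_trans_sym x that by blast
  qed
qed

end
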